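(* Let $k\ge 1$ be an integer. Suppose that Conjecture 1 holds, i.e. for every function $\psi:\mathbb{R}^+\to\mathbb{R}^+$, $$\sum_{n=1}^{\infty}\left(\frac{\phi(n)\,\psi(n)}{n}\right)^k=\infty\quad\Longrightarrow\quad m(\mathcal{S}_k(\psi))=1 .$$ Then Conjecture 2 holds, i.e. for every function $\psi:\mathbb{R}^+\to\mathbb{R}^+$ and every dimension function $f$ such that $r\mapsto r^{-k}f(r)$ is monotonic, $$\sum_{n=1}^{\infty} f\!\left(\frac{\psi(n)}{n}\right)\phi(n)^k=\infty\quad\Longrightarrow\quad \mathcal{H}^f(\mathcal{S}_k(\psi))=\mathcal{H}^f([0,1]^k).$$
   Context: $\mathbb{R}^+=(0,\infty)$; $\phi$ is the Euler function; $m$ is $k$-dimensional Lebesgue measure. For $\psi:\mathbb{R}^+\to\mathbb{R}^+$ (an approximating function), $\mathcal{S}_k(\psi)$ is the set of points $\mathbf{y}=(y_1,\dots,y_k)\in[0,1]^k$ for which there are infinitely many $q\in\mathbb{N}$ and $\mathbf{p}=(p_1,\dots,p_k)\in\mathbb{Z}^k$ such that $\left|y_i-\frac{p_i}{q}\right|<\frac{\psi(q)}{q}$ and $\gcd(p_i,q)=1$ for all $1\le i\le k$. A dimension function is a continuous, nondecreasing function $f:\mathbb{R}^+\to\mathbb{R}^+$ with $f(r)\to0$ as $r\to0$. Balls are closed balls $B(x,r)=\{y: d(x,y)\le r\}$ with fixed centre $x$ and radius $r>0$. For $F\subset\mathbb{R}^k$ and $\rho>0$, let $\mathcal{H}^f_\rho(F)=\inf\sum_i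 f(r(B_i))$, the infimum being over all countable collections of balls $\{B_i\}$ with radii $r(B_i)\le\rho$ and $F\subset\bigcup_iB_i$. The Hausdorff $f$-measure is $\mathcal{H}^f(F)=\lim_{\rho\to0}\mathcal{H}^f_\rho(F)=\sup_{\rho>0}\mathcal{H}^f_\rho(F)$. *)

theory Defs
  imports "HOL-Analysis.Analysis" "HOL-Number_Theory.Totient"
begin

text \<open>
  The dimension \<open>k\<close> is \<open>CARD('k)\<close>. A function from the positive reals to the positive
  reals is a total function on \<open>real\<close> that is positive on \<open>{0<..}\<close>; its values
  elsewhere are irrelevant.
\<close>

definition pos_fun :: "(real \<Rightarrow> real) \<Rightarrow> bool" where
  "pos_fun g \<longleftrightarrow> (\<forall>x>0. g x > 0)"

definition dimension_function :: "(real \<Rightarrow> real) \<Rightarrow> bool" where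
  "dimension_function f \<longleftrightarrow>
     pos_fun f \<and> continuous_on {0<..} f \<and> mono_on {0<..} f \<and> (f \<longlongrightarrow> 0) (at_right 0)"

definition duffin_schaeffer_set :: "(real \<Rightarrow> real) \<Rightarrow> (real ^ 'k) set" where
  "duffin_schaeffer_set \<psi> =
     {y \<in> cbox 0 1.
        infinite {(q :: nat, p :: int ^ 'k).
          q \<ge> 1 \<and>
          (\<forall>i. \<bar>y $ i - of_int (p $ i) / real q\<bar> < \<psi> (real q) / real q \<and>
               gcd (p $ i) (int q) = 1)}}"

text \<open>
  Covers are by closed Euclidean balls of positive radius, and the radius (not the diameter)
  is the argument of \<open>f\<close>. The index set \<open>I\<close> ranges over all sets of naturals, so that
  finite and empty covers are included.
\<close>

definition hausdorff_premeasure ::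
    "(real \<Rightarrow> real) \<Rightarrow> real \<Rightarrow> (real ^ 'k) set \<Rightarrow> ennreal" where
  "hausdorff_premeasure f \<rho> F =
     Inf {(\<Sum>\<^sub>\<infinity>i\<in>I. ennreal (f (r i))) | (I :: nat set) (c :: nat \<Rightarrow> real ^ 'k) (r :: nat \<Rightarrow> real).
            (\<forall>i\<in>I. 0 < r i \<and> r i \<le> \<rho>) \<and> F \<subseteq> (\<Union>i\<in>I. cball (c i) (r i))}"

definition hausdorff_measure :: "(real \<Rightarrow> real) \<Rightarrow> (real ^ 'k) set \<Rightarrow> ennreal" where
  "hausdorff_measure f F = (SUP \<rho>\<in>{0<..}. hausdorff_premeasure f \<rho> F)"

end

theory Submission
  imports Defs
begin

text \<open>
  Write \<open>k\<close> for the dimension, \<open>S(\<psi>)\<close> for the limsup set of \<open>\<psi>\<close>, and \<open>x\<^sub>n = \<psi>(n) / n\<close>. The proof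
  separates two cases according to the behaviour of \<open>f(r) / r\<^sup>k\<close> as \<open>r\<close> tends to \<open>0\<close>.

  If \<open>f(r) \<le> A r\<^sup>k\<close> for small \<open>r\<close>, which includes the case where \<open>f(r) / r\<^sup>k\<close> is nondecreasing, then
  divergence of \<open>\<Sum> f(x\<^sub>n) \<phi>(n)\<^sup>k\<close> forces divergence of \<open>\<Sum> (\<phi>(n) x\<^sub>n)\<^sup>k\<close>, so \<open>S(\<psi>)\<close> has full Lebesgue
  measure in the unit cube. A Lebesgue null set is null for the Hausdorff \<open>f\<close>-measure
  (\<open>premeasure_negligible\<close>, by Vitali's covering lemma), and the two Hausdorff measures agree.

  Otherwise \<open>f(r) / r\<^sup>k\<close> is nonincreasing and tends to infinity, and both sides are infinite. If
  \<open>x\<^sub>n\<close> does not tend to \<open>0\<close>, then \<open>\<Sum> (\<phi>(n) x\<^sub>n)\<^sup>k\<close> diverges, and a set of positive Lebesgue measure has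
  infinite Hausdorff \<open>f\<close>-measure (\<open>volume_le_premeasure\<close>). If \<open>x\<^sub>n\<close> tends to \<open>0\<close>, apply the hypothesis
  to \<open>\<theta>(n) = n f(x\<^sub>n)\<^bsup>1/k\<^esup>\<close>: the sum for \<open>\<theta>\<close> is the given divergent one, so \<open>S(\<theta>)\<close> has full measure.
  It remains to pass from the large balls of radius comparable to \<open>f(x\<^sub>n)\<^bsup>1/k\<^esup>\<close> to the small concentric
  balls of radius comparable to \<open>x\<^sub>n\<close>; this is the mass transference principle of Beresnevich and Velani
  (\<open>hausdorff_measure_mass_transference\<close>).

  The mass transference principle is obtained without constructing a measure on a Cantor set. Start from a
  multiple of Lebesgue measure on an open set. In one step, choose by Vitali's theorem finitely many disjoint
  large balls that carry almost all of the mass, and move the mass of each of them onto its concentric small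
  ball. At most one large ball whose radius is big compared with \<open>r\<close> contributes to a ball \<open>B\<close> of
  radius \<open>r\<close>; it gives \<open>B\<close> a mass at most a constant times \<open>f(r)\<close>, and at all scales outside
  some interval the mass of \<open>B\<close> hardly exceeds the old bound (\<open>concentrate\<close>). Averaging \<open>N\<close> such
  redistributions with disjoint ranges of scales divides the constant by \<open>N\<close>, so the bound
  on the mass of a ball grows only by a factor as close to \<open>1\<close> as desired (\<open>spread\<close>). Iteration gives measures on a decreasing
  sequence of compact sets whose intersection lies in the limsup set of the small balls, all satisfying the
  same bound. A cover of the limsup set, after doubling of the radii, covers one of these compact sets, and
  the mass there bounds the cost of the cover from below (\<open>cover_bound\<close>). This lower bound is
  arbitrarily large: the gauge used is \<open>g(r) = f(r) + L r\<^sup>k\<close>, which is comparable with \<open>f\<close> at small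
  scales, while the initial mass is proportional to the arbitrary number \<open>L\<close>.
\<close>

section \<open>Measures with bounded density\<close>

text \<open>The mass that the measure with density \<open>h\<close> with respect to Lebesgue measure gives to a set.\<close>

definition mass :: "('a::euclidean_space \<Rightarrow> real) \<Rightarrow> 'a set \<Rightarrow> ennreal" where
  "mass h = emeasure (density lborel (\<lambda>x. ennreal (h x)))"

text \<open>A nonnegative bounded Borel function vanishing outside \<open>U\<close>.\<close>

definition bounded_density :: "'a::euclidean_space set \<Rightarrow> ('a \<Rightarrow> real) \<Rightarrow> bool" where
  "bounded_density U h \<longleftrightarrow> h \<in> borel_measurable borel \<and> (\<forall>x. 0 \<le> h x) \<and>
     (\<exists>H. \<forall>x. h x \<le> H) \<and> (\<forall>x. x \<notin> U \<longrightarrow> h x = 0)"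

lemma mass_eq:
  assumes "h \<in> borel_measurable borel" "A \<in> sets borel"
  shows "mass h A = (\<integral>\<^sup>+x. ennreal (h x) * indicator A x \<partial>lborel)"
  using assms by (simp add: mass_def emeasure_density)

lemma mass_mono: "A \<subseteq> B \<Longrightarrow> B \<in> sets borel \<Longrightarrow> mass h A \<le> mass h B"
  unfolding mass_def by (rule emeasure_mono) auto

lemma mass_le_bound:
  assumes "h \<in> borel_measurable borel" "A \<in> sets borel" "\<And>x. h x \<le> H"
  shows "mass h A \<le> ennreal H * emeasure lborel A"
proof -
  have "mass h A \<le> (\<integral>\<^sup>+x. ennreal H * indicator A x \<partial>lborel)"
    unfolding mass_eq[OF assms(1,2)]
    by (intro nn_integral_mono mult_right_mono ennreal_leI assms(3)) auto
  also have "\<dots> = ennreal H * emeasure lborel A"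
    using assms(2) by (simp add: nn_integral_cmult_indicator)
  finally show ?thesis .
qed

lemma mass_cball_le:
  fixes h :: "'a::euclidean_space \<Rightarrow> real"
  assumes "h \<in> borel_measurable borel" "\<And>x. h x \<le> H" "0 \<le> H" "0 \<le> r"
  shows "mass h (cball x r) \<le> ennreal (H * unit_ball_vol (real DIM('a)) * r ^ DIM('a))"
proof -
  have "mass h (cball x r) \<le> ennreal H * emeasure lborel (cball x r)"
    using assms by (intro mass_le_bound) auto
  also have "\<dots> = ennreal (H * unit_ball_vol (real DIM('a)) * r ^ DIM('a))"
    using assms by (simp add: emeasure_cball ennreal_mult' mult.assoc)
  finally show ?thesis .
qed

lemma mass_add:
  assumes "h \<in> borel_measurable borel" "h' \<in> borel_measurable borel"
    "\<And>x. 0 \<le> h x" "\<And>x. 0 \<le> h' x" "A \<in> sets borel"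
  shows "mass (\<lambda>x. h x + h' x) A = mass h A + mass h' A"
  using assms by (simp add: mass_eq distrib_right nn_integral_add)

lemma mass_cmult:
  assumes "h \<in> borel_measurable borel" "\<And>x. 0 \<le> h x" "0 \<le> c" "A \<in> sets borel"
  shows "mass (\<lambda>x. c * h x) A = ennreal c * mass h A"
  using assms by (simp add: mass_eq ennreal_mult' mult.assoc nn_integral_cmult)

lemma mass_indicator_sum:
  assumes "finite F" "\<And>j. j \<in> F \<Longrightarrow> 0 \<le> w j" "\<And>j. j \<in> F \<Longrightarrow> b j \<in> sets borel" "A \<in> sets borel"
  shows "mass (\<lambda>x. \<Sum>j\<in>F. w j * indicator (b j) x) A = (\<Sum>j\<in>F. ennreal (w j) * emeasure lborel (b j \<inter> A))"
proof -
  have [measurable]: "(\<lambda>x. \<Sum>j\<in>F. w j * indicator (b j) x) \<in> borel_measurable borel"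
    by (intro borel_measurable_sum borel_measurable_times borel_measurable_const
        borel_measurable_indicator assms(3))
  have "ennreal (\<Sum>j\<in>F. w j * indicator (b j) x) * indicator A x
      = (\<Sum>j\<in>F. ennreal (w j) * indicator (b j \<inter> A) x)" for x
  proof -
    have "ennreal (\<Sum>j\<in>F. w j * indicator (b j) x) = (\<Sum>j\<in>F. ennreal (w j * indicator (b j) x))"
      by (rule sum_ennreal[symmetric]) (simp add: assms(2))
    also have "\<dots> = (\<Sum>j\<in>F. ennreal (w j) * indicator (b j) x)"
      by (intro sum.cong refl) (simp add: indicator_def)
    also have "\<dots> * indicator A x = (\<Sum>j\<in>F. ennreal (w j) * indicator (b j \<inter> A) x)"
      unfolding sum_distrib_right
      by (intro sum.cong refl) (simp add: indicator_inter_arith mult.assoc)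
    finally show ?thesis .
  qed
  then have "mass (\<lambda>x. \<Sum>j\<in>F. w j * indicator (b j) x) A
      = (\<integral>\<^sup>+x. (\<Sum>j\<in>F. ennreal (w j) * indicator (b j \<inter> A) x) \<partial>lborel)"
    using assms(4) by (subst mass_eq) auto
  also have "\<dots> = (\<Sum>j\<in>F. ennreal (w j) * emeasure lborel (b j \<inter> A))"
    using assms by (subst nn_integral_sum) (auto intro!: sum.cong nn_integral_cmult_indicator)
  finally show ?thesis .
qed

lemma mass_support:
  assumes "bounded_density U h" "U \<in> sets borel"
  shows "mass h U = mass h UNIV"
  using assms unfolding bounded_density_def
  by (auto simp: mass_eq indicator_def intro!: nn_integral_cong)

lemma mass_finite:
  assumes "bounded_density U h" "open U" "bounded U"
  shows "mass h UNIV < \<infinity>"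
proof -
  obtain H where H: "\<And>x. h x \<le> H" using assms(1) by (auto simp: bounded_density_def)
  have "mass h U \<le> ennreal H * emeasure lborel U"
    using assms H by (intro mass_le_bound) (auto simp: bounded_density_def)
  also have "\<dots> < \<infinity>"
    using emeasure_bounded_finite[OF assms(3)] by (simp add: ennreal_mult_less_top)
  finally show ?thesis using mass_support[OF assms(1)] assms by simp
qed

lemma mass_null:
  assumes "h \<in> borel_measurable borel" "negligible N" "A \<in> sets borel" "A \<subseteq> N"
  shows "mass h A = 0"
proof -
  have "A \<in> null_sets lborel"
    using negligible_subset[OF assms(2,4)] assms(3)
    by (simp add: negligible_iff_null_sets null_sets_completion_iff)
  then have "emeasure lborel A = 0" by auto
  then have "AE x in lborel. ennreal (h x) * indicator A x = 0"
    using \<open>A \<in> null_sets lborel\<close> by (auto dest!: AE_not_in elim!: eventually_mono simp: indicator_def)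
  then show ?thesis using assms by (simp add: mass_eq nn_integral_0_iff_AE)
qed

section \<open>The mass transference construction\<close>

text \<open>The setting of the construction. The balls with centres in \<open>P q\<close> have two radii, the small one
  \<open>\<rho> q\<close> and the large one \<open>R q\<close>, linked by \<open>R q ^ DIM('a) \<le> E * g (\<rho> q)\<close>. The gauge \<open>g\<close> is
  nondecreasing; \<open>g_scale\<close> says that \<open>g r / r ^ DIM('a)\<close> is nonincreasing, and \<open>g_dominates\<close> that this
  quotient tends to infinity at \<open>0\<close>. The last assumption says that almost every point of \<open>U\<^sub>0\<close> lies in large
  balls of infinitely many generations \<open>q\<close>. No condition is put on the sets \<open>P q\<close>.\<close>

locale mass_transference =
  fixes g :: "real \<Rightarrow> real" and P :: "nat \<Rightarrow> 'a::euclidean_space set"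
    and \<rho> R :: "nat \<Rightarrow> real" and E :: real and U\<^sub>0 :: "'a set"
  assumes g_pos: "0 < r \<Longrightarrow> 0 < g r"
    and g_mono: "0 < r \<Longrightarrow> r \<le> s \<Longrightarrow> g r \<le> g s"
    and g_scale: "0 < r \<Longrightarrow> 1 \<le> t \<Longrightarrow> g (t * r) \<le> t ^ DIM('a) * g r"
    and g_dominates: "\<exists>s>0. \<forall>r. 0 < r \<longrightarrow> r \<le> s \<longrightarrow> A * r ^ DIM('a) \<le> g r"
    and \<rho>_pos: "0 < \<rho> q"
    and \<rho>_le_R: "\<forall>\<^sub>F q in sequentially. 8 * \<rho> q \<le> R q"
    and R_tendsto: "R \<longlonglongrightarrow> 0"
    and R_pow: "R q ^ DIM('a) \<le> E * g (\<rho> q)"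
    and E_pos: "0 < E"
    and open_U0: "open U\<^sub>0" and bounded_U0: "bounded U\<^sub>0"
    and abundant: "negligible {x \<in> U\<^sub>0. finite {q. \<exists>c\<in>P q. x \<in> cball c (R q)}}"
begin

text \<open>Vitali's covering theorem: finitely many disjoint large balls of late generations carry a proportion
  \<open>1 / \<kappa>\<close> of the mass. Members of the family are pairs of a generation and a centre.\<close>

lemma finite_disjoint_big_balls:
  assumes U: "open U" "U \<subseteq> U\<^sub>0" and h: "bounded_density U h"
    and \<kappa>: "1 < \<kappa>" and \<delta>: "0 < \<delta>"
  obtains F where "finite F"
    "\<And>q c. (q, c) \<in> F \<Longrightarrow> q \<ge> Q \<and> c \<in> P q \<and> 8 * \<rho> q \<le> R q \<and> R q < \<delta> \<and> cball c (R q) \<subseteq> U"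
    "pairwise (\<lambda>i j. disjnt (cball (snd i) (R (fst i))) (cball (snd j) (R (fst j)))) F"
    "mass h UNIV \<le> ennreal \<kappa> * mass h (\<Union>j\<in>F. cball (snd j) (R (fst j)))"
proof -
  define K where "K = {(q, c). q \<ge> Q \<and> c \<in> P q \<and> 8 * \<rho> q \<le> R q \<and> R q < \<delta> \<and> cball c (R q) \<subseteq> U}"
  define S where "S = {x\<in>U. infinite {q. \<exists>c\<in>P q. x \<in> cball c (R q)}}"
  define B :: "nat \<times> 'a \<Rightarrow> 'a set" where "B j = cball (snd j) (R (fst j))" for j
  have Rpos: "0 < R (fst i)" if "i \<in> K" for i
    using that \<rho>_pos[of "fst i"] by (auto simp: K_def)
  have fine: "\<exists>i. i \<in> K \<and> x \<in> cball (snd i) (R (fst i)) \<and> R (fst i) < d"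
    if x: "x \<in> S" and d: "0 < d" for x d
  proof -
    from x have "x \<in> U" by (simp add: S_def)
    then obtain e where e: "e > 0" "ball x e \<subseteq> U" using U(1) open_contains_ball by blast
    have "\<forall>\<^sub>F q in sequentially. R q < min (min d \<delta>) (e/2)"
      using R_tendsto d \<delta> e(1) by (intro order_tendstoD) auto
    then have "\<forall>\<^sub>F q in sequentially. q \<ge> Q \<and> 8 * \<rho> q \<le> R q \<and> R q < min (min d \<delta>) (e/2)"
      using \<rho>_le_R eventually_ge_at_top[of Q] by eventually_elim auto
    then obtain q0 where q0: "\<And>q. q \<ge> q0 \<Longrightarrow> q \<ge> Q \<and> 8 * \<rho> q \<le> R q \<and> R q < min (min d \<delta>) (e/2)"
      by (auto simp: eventually_sequentially)
    have "infinite {q. \<exists>c\<in>P q. x \<in> cball c (R q)}" using x by (simp add: S_def)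
    then obtain q c where q: "q \<ge> q0" "c \<in> P q" "x \<in> cball c (R q)"
      unfolding infinite_nat_iff_unbounded_le by blast
    have "cball c (R q) \<subseteq> ball x e"
    proof
      fix y assume "y \<in> cball c (R q)"
      then have "dist x y \<le> R q + R q"
        using q(3) dist_triangle2[of x y c] by (simp add: dist_commute)
      then show "y \<in> ball x e" using q0[OF q(1)] by simp
    qed
    then have "(q, c) \<in> K" using e(2) q q0[OF q(1)] by (auto simp: K_def)
    then show ?thesis using q q0[OF q(1)] by (intro exI[of _ "(q,c)"]) auto
  qed
  obtain C where C: "countable C" "C \<subseteq> K"
     "pairwise (\<lambda>i j. disjnt (cball (snd i) (R (fst i))) (cball (snd j) (R (fst j)))) C"
     "negligible (S - (\<Union>i \<in> C. cball (snd i) (R (fst i))))"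
    using Vitali_covering_theorem_cballs[of K "\<lambda>i. R (fst i)" S snd, OF Rpos fine] by blast
  have hm: "h \<in> borel_measurable borel" using h by (simp add: bounded_density_def)
  \<comment> \<open>the first members of the countable family; their masses converge to the total mass\<close>
  define A where "A n = (\<Union>i\<in>{i\<in>C. to_nat_on C i \<le> n}. B i)" for n
  have Cn: "finite {i\<in>C. to_nat_on C i \<le> n}" for n
    by (rule finite_imageD[of "to_nat_on C"])
       (auto intro: finite_subset[of _ "{..n}"] inj_on_subset[OF inj_on_to_nat_on[OF C(1)]])
  have Abor: "A n \<in> sets borel" for n
    unfolding A_def B_def by (intro sets.finite_UN Cn) auto
  have UA: "(\<Union>n. A n) = (\<Union>i\<in>C. B i)" by (auto simp: A_def)
  have UAb: "(\<Union>n. A n) \<in> sets borel" using Abor by auto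
  have "U - (\<Union>n. A n) \<subseteq> {x \<in> U\<^sub>0. finite {q. \<exists>c\<in>P q. x \<in> cball c (R q)}}
       \<union> (S - (\<Union>i \<in> C. cball (snd i) (R (fst i))))"
    using U(2) unfolding UA by (auto simp: S_def B_def)
  then have "mass h (U - (\<Union>n. A n)) = 0"
    using mass_null[OF hm negligible_Un[OF abundant C(4)]] U(1) UAb by auto
  then have "mass h UNIV \<le> mass h (\<Union>n. A n)"
    using mass_support[OF h] U(1) UAb
      emeasure_subadditive[of "U - (\<Union>n. A n)" "density lborel (\<lambda>x. ennreal (h x))" "\<Union>n. A n"]
      mass_mono[of U "U - (\<Union>n. A n) \<union> (\<Union>n. A n)" h]
    by (simp add: mass_def)
  then have full: "mass h (\<Union>n. A n) = mass h UNIV"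
    using UAb mass_mono[of "\<Union>n. A n" UNIV h] by (intro antisym) auto
  have lim: "(\<lambda>n. mass h (A n)) \<longlonglongrightarrow> mass h (\<Union>n. A n)"
    unfolding mass_def
  proof (rule Lim_emeasure_incseq)
    show "range A \<subseteq> sets (density lborel (\<lambda>x. ennreal (h x)))" using Abor by auto
    show "incseq A" by (force simp: A_def incseq_def)
  qed
  have "\<exists>n. mass h UNIV \<le> ennreal \<kappa> * mass h (A n)"
  proof (cases "mass h UNIV = 0")
    case False
    have "mass h UNIV < \<infinity>"
      using mass_finite[OF h U(1)] bounded_subset[OF bounded_U0 U(2)] by simp
    then obtain m where m: "mass h UNIV = ennreal m" "0 \<le> m" by (cases "mass h UNIV") auto
    with False have "0 < m" by (cases "m = 0") auto
    have "ennreal (m / \<kappa>) < mass h UNIV"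
      unfolding m(1) using \<kappa> \<open>0 < m\<close> by (subst ennreal_less_iff) (auto simp: field_simps)
    with lim have "\<forall>\<^sub>F n in sequentially. ennreal (m / \<kappa>) < mass h (A n)"
      unfolding full by (rule order_tendstoD)
    then obtain n where n: "ennreal (m / \<kappa>) < mass h (A n)" by (auto dest: eventually_happens)
    have "mass h UNIV = ennreal \<kappa> * ennreal (m / \<kappa>)"
      using \<kappa> m by (simp add: ennreal_mult'[symmetric])
    also have "\<dots> \<le> ennreal \<kappa> * mass h (A n)" using n by (intro mult_left_mono) auto
    finally show ?thesis ..
  qed auto
  then obtain n where "mass h UNIV \<le> ennreal \<kappa> * mass h (A n)" ..
  moreover have "{i\<in>C. to_nat_on C i \<le> n} \<subseteq> K" using C(2) by auto
  ultimately show ?thesis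
    using that[of "{i\<in>C. to_nat_on C i \<le> n}"] Cn[of n] pairwise_subset[OF C(3), of "{i\<in>C. to_nat_on C i \<le> n}"]
    by (auto simp: A_def B_def K_def subset_iff)
qed

text \<open>A density living on the finitely many small balls indexed by \<open>F\<close>, all of generation at least
  \<open>Q\<close>, whose closed versions lie inside \<open>U\<close>.\<close>

definition layer :: "nat \<Rightarrow> 'a set \<Rightarrow> (nat \<times> 'a) set \<Rightarrow> ('a \<Rightarrow> real) \<Rightarrow> bool" where
  "layer Q U F h \<longleftrightarrow> finite F \<and> (\<forall>(q, c)\<in>F. q \<ge> Q \<and> c \<in> P q \<and> cball c (\<rho> q) \<subseteq> U) \<and>
     bounded_density (\<Union>(q, c)\<in>F. ball c (\<rho> q)) h"

text \<open>One redistribution of mass from large balls to small ones. The constant \<open>B\<close> depends on the given density but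
  not on \<open>Q\<close> and \<open>\<delta>\<close>, and the new bound is worse than \<open>\<kappa> * a * g r\<close> only for radii in the
  interval between \<open>s\<close> and \<open>\<delta>\<close>. Since \<open>\<delta>\<close> is arbitrary, such intervals can be made
  disjoint for successive redistributions.\<close>

lemma concentrate:
  assumes U: "open U" "U \<subseteq> U\<^sub>0" and h: "bounded_density U h"
    and a: "0 < a" and frostman: "\<And>x r. 0 < r \<Longrightarrow> mass h (cball x r) \<le> ennreal (a * g r)"
    and \<kappa>: "1 < \<kappa>"
  obtains B where "0 \<le> B"
    "\<And>Q \<delta>. 0 < \<delta> \<Longrightarrow> \<exists>h' F s. 0 < s \<and> s < \<delta> \<and> layer Q U F h' \<and>
        mass h UNIV \<le> ennreal \<kappa> * mass h' UNIV \<and>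
        (\<forall>x r. 0 < r \<longrightarrow> mass h' (cball x r) \<le> ennreal (B * g r)) \<and>
        (\<forall>x r. 0 < r \<longrightarrow> r \<le> s \<or> \<delta> \<le> r \<longrightarrow> mass h' (cball x r) \<le> ennreal (\<kappa> * a * g r))"
proof -
  define k where "k = DIM('a)"
  have k: "0 < k" by (simp add: k_def)
  define V where "V = unit_ball_vol (real DIM('a))"
  have V: "0 < V" by (simp add: V_def)
  obtain H where hH: "\<And>x. h x \<le> H" using h by (auto simp: bounded_density_def)
  have hm: "h \<in> borel_measurable borel" and h0: "\<And>x. 0 \<le> h x"
    using h by (auto simp: bounded_density_def)
  have H0: "0 \<le> H" using h0[of undefined] hH[of undefined] by simp
  define B where "B = H * V * E + a * 6 ^ k"
  have "0 \<le> B" using H0 V E_pos a by (simp add: B_def)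
  moreover have "\<exists>h' F s. 0 < s \<and> s < \<delta> \<and> layer Q U F h' \<and>
        mass h UNIV \<le> ennreal \<kappa> * mass h' UNIV \<and>
        (\<forall>x r. 0 < r \<longrightarrow> mass h' (cball x r) \<le> ennreal (B * g r)) \<and>
        (\<forall>x r. 0 < r \<longrightarrow> r \<le> s \<or> \<delta> \<le> r \<longrightarrow> mass h' (cball x r) \<le> ennreal (\<kappa> * a * g r))"
    if \<delta>: "0 < \<delta>" for Q \<delta>
  proof -
    \<comment> \<open>large balls of radius below this bound enlarge a radius \<open>r \<ge> \<delta>\<close> by at most the factor \<open>root k \<kappa>\<close>\<close>
    define \<delta>1 where "\<delta>1 = \<delta> / 2 * (root k \<kappa> - 1)"
    have "1 < root k \<kappa>" using \<kappa> k by simp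
    then have \<delta>1: "0 < \<delta>1" using \<delta> by (simp add: \<delta>1_def)
    obtain F where F: "finite F"
      "\<And>q c. (q, c) \<in> F \<Longrightarrow> q \<ge> Q \<and> c \<in> P q \<and> 8 * \<rho> q \<le> R q \<and> R q < \<delta>1 \<and> cball c (R q) \<subseteq> U"
      "pairwise (\<lambda>i j. disjnt (cball (snd i) (R (fst i))) (cball (snd j) (R (fst j)))) F"
      "mass h UNIV \<le> ennreal \<kappa> * mass h (\<Union>j\<in>F. cball (snd j) (R (fst j)))"
      by (rule finite_disjoint_big_balls[OF U h \<kappa> \<delta>1, where Q = Q]) (rule that; assumption)
    define big where "big j = cball (snd j) (R (fst j))" for j :: "nat \<times> 'a"
    define small where "small j = ball (snd j) (\<rho> (fst j))" for j :: "nat \<times> 'a"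
    define m where "m j = enn2real (mass h (big j))" for j
    \<comment> \<open>\<open>w j\<close> is the density that spreads the mass \<open>m j\<close> of the large ball evenly over the small ball\<close>
    define w where "w j = m j / (V * \<rho> (fst j) ^ k)" for j
    define h' where "h' x = (\<Sum>j\<in>F. w j * indicator (small j) x)" for x
    have disj: "disjoint_family_on big F"
      using F(3) unfolding disjoint_family_on_def big_def by (simp add: pairwise_def disjnt_def)
    have big_borel: "big j \<in> sets borel" for j by (simp add: big_def)
    have \<rho>0: "0 < \<rho> q" for q by (rule \<rho>_pos)
    have FR: "8 * \<rho> (fst j) \<le> R (fst j)" "0 < R (fst j)" "R (fst j) < \<delta>1" if "j \<in> F" for j
      using F(2)[of "fst j" "snd j"] that \<rho>0[of "fst j"] by auto
    have massbig: "mass h (big j) = ennreal (m j)" "m j \<le> H * V * E * g (\<rho> (fst j))" "0 \<le> m j"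
      if "j \<in> F" for j
    proof -
      have *: "mass h (big j) \<le> ennreal (H * V * R (fst j) ^ k)"
        unfolding big_def V_def k_def
        using FR[OF that] by (intro mass_cball_le hm hH H0) auto
      then have "mass h (big j) < \<infinity>" by (rule le_less_trans) simp
      then show 1: "mass h (big j) = ennreal (m j)" unfolding m_def by simp
      show "0 \<le> m j" by (simp add: m_def)
      have "m j \<le> H * V * R (fst j) ^ k"
        using * FR[OF that] H0 V unfolding 1 by (subst (asm) ennreal_le_iff) auto
      also have "\<dots> \<le> H * V * (E * g (\<rho> (fst j)))"
        using R_pow H0 V unfolding k_def by (intro mult_left_mono) auto
      finally show "m j \<le> H * V * E * g (\<rho> (fst j))" by (simp add: mult.assoc)
    qed
    have w0: "0 \<le> w j" if "j \<in> F" for j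
      using massbig(3)[OF that] V \<rho>0 by (simp add: w_def less_imp_le)
    define T where "T j A = ennreal (w j) * emeasure lborel (small j \<inter> A)" for j A
    have mass': "mass h' A = (\<Sum>j\<in>F. T j A)" if "A \<in> sets borel" for A
      unfolding h'_def T_def using F(1) w0 that by (intro mass_indicator_sum) (auto simp: small_def)
    have Tfull: "T j UNIV = mass h (big j)" if "j \<in> F" for j
    proof -
      have "T j UNIV = ennreal (w j) * ennreal (V * \<rho> (fst j) ^ k)"
        using \<rho>0[of "fst j"] by (simp add: T_def small_def emeasure_ball V_def k_def)
      also have "\<dots> = ennreal (m j)"
        using w0[OF that] V \<rho>0[of "fst j"] by (simp add: ennreal_mult'[symmetric] w_def)
      finally show ?thesis using massbig[OF that] by simp
    qed
    have T1: "T j A \<le> mass h (big j)" if "j \<in> F" "A \<in> sets borel" for j A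
      using Tfull[OF that(1)] unfolding T_def
      by (metis Int_UNIV_right Int_lower1 emeasure_mono mult_left_mono small_def borel_open open_ball
          sets_lborel zero_le)
    have T2: "T j (cball x r) \<le> ennreal (m j * (r / \<rho> (fst j)) ^ k)" if "j \<in> F" "0 < r" for j x r
    proof -
      have "T j (cball x r) \<le> ennreal (w j) * emeasure lborel (cball x r)"
        unfolding T_def by (intro mult_left_mono emeasure_mono) auto
      also have "\<dots> = ennreal (w j * (V * r ^ k))"
        using that w0[OF that(1)] by (simp add: emeasure_cball V_def k_def ennreal_mult')
      also have "w j * (V * r ^ k) = m j * (r / \<rho> (fst j)) ^ k"
        using V by (simp add: w_def power_divide)
      finally show ?thesis .
    qed
    \<comment> \<open>the share of one small ball: monotonicity of \<open>g\<close> if \<open>\<rho> \<le> r\<close>, and of \<open>g r / r ^ k\<close> otherwise\<close>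
    have single: "T j (cball x r) \<le> ennreal (H * V * E * g r)" if "j \<in> F" "0 < r" for j x r
    proof (cases "\<rho> (fst j) \<le> r")
      case True
      have "T j (cball x r) \<le> ennreal (m j)" using T1[OF that(1), of "cball x r"] massbig(1)[OF that(1)] by simp
      also have "\<dots> \<le> ennreal (H * V * E * g r)"
      proof (rule ennreal_leI)
        have "H * V * E * g (\<rho> (fst j)) \<le> H * V * E * g r"
          using g_mono[OF \<rho>0 True] H0 V E_pos by (intro mult_left_mono) auto
        then show "m j \<le> H * V * E * g r" using massbig(2)[OF that(1)] by simp
      qed
      finally show ?thesis .
    next
      case False
      have "g (\<rho> (fst j) / r * r) \<le> (\<rho> (fst j) / r) ^ k * g r"
        unfolding k_def using False that by (intro g_scale) auto
      then have "g (\<rho> (fst j)) * (r / \<rho> (fst j)) ^ k \<le> g r"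
        using that \<rho>0[of "fst j"] by (simp add: power_divide field_simps)
      then have "H * V * E * (g (\<rho> (fst j)) * (r / \<rho> (fst j)) ^ k) \<le> H * V * E * g r"
        using H0 V E_pos by (intro mult_left_mono) auto
      moreover have "m j * (r / \<rho> (fst j)) ^ k \<le> H * V * E * g (\<rho> (fst j)) * (r / \<rho> (fst j)) ^ k"
        using massbig(2)[OF that(1)] that \<rho>0[of "fst j"] by (intro mult_right_mono) auto
      ultimately have "m j * (r / \<rho> (fst j)) ^ k \<le> H * V * E * g r" by (simp add: mult.assoc)
      then show ?thesis using T2[OF that, of x] ennreal_leI order_trans by blast
    qed
    \<comment> \<open>large balls contained in a ball are controlled by the old measure of that ball\<close>
    have several: "(\<Sum>j\<in>G. T j A) \<le> ennreal (a * g t)"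
      if "G \<subseteq> F" "A \<in> sets borel" "0 < t" "\<And>j. j \<in> G \<Longrightarrow> big j \<subseteq> cball x t" for G A x t
    proof -
      have "finite G" using that(1) F(1) finite_subset by blast
      have "(\<Sum>j\<in>G. T j A) \<le> (\<Sum>j\<in>G. mass h (big j))"
        using that T1 by (intro sum_mono) auto
      also have "\<dots> = mass h (\<Union>j\<in>G. big j)"
        unfolding mass_def
        using \<open>finite G\<close> disjoint_family_on_mono[OF that(1) disj]
        by (intro sum_emeasure) (auto simp: big_borel)
      also have "\<dots> \<le> mass h (cball x t)"
        using that(4) by (intro mass_mono) auto
      also have "\<dots> \<le> ennreal (a * g t)" using frostman that(3) by simp
      finally show ?thesis .
    qed
    define near where "near x r = {j\<in>F. small j \<inter> cball x r \<noteq> {}}" for x r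
    have mass_near: "mass h' (cball x r) = (\<Sum>j\<in>near x r. T j (cball x r))" for x r
    proof -
      have "T j (cball x r) = 0" if "j \<in> F - near x r" for j
        using that by (simp add: near_def T_def)
      then show ?thesis
        unfolding mass'[of "cball x r", simplified]
        using F(1) by (intro sum.mono_neutral_right) (auto simp: near_def)
    qed
    have centre: "dist x (snd j) \<le> r + \<rho> (fst j)" if "j \<in> near x r" for j x r
    proof -
      obtain y where "y \<in> small j" "y \<in> cball x r"
        using \<open>j \<in> near x r\<close> unfolding near_def by blast
      then show ?thesis using dist_triangle[of x "snd j" y]
        by (simp add: small_def dist_commute)
    qed
    have inball: "big j \<subseteq> cball x t" if "j \<in> near x r" "r + \<rho> (fst j) + R (fst j) \<le> t" for j x r t
    proof
      fix y assume "y \<in> big j"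
      then show "y \<in> cball x t"
        using centre[OF that(1)] that(2) dist_triangle[of x y "snd j"] by (simp add: big_def)
    qed
    have nearF: "near x r \<subseteq> F" for x r by (auto simp: near_def)
    have allr: "mass h' (cball x r) \<le> ennreal (B * g r)" if r: "0 < r" for x r
    proof -
      define G where "G = {j\<in>near x r. R (fst j) \<le> 4 * r}"
      define G' where "G' = {j\<in>near x r. 4 * r < R (fst j)}"
      have fin: "finite G" "finite G'"
        using finite_subset[OF nearF F(1)] by (auto simp: G_def G'_def)
      have "mass h' (cball x r) = (\<Sum>j\<in>G \<union> G'. T j (cball x r))"
        unfolding mass_near by (rule sum.cong) (auto simp: G_def G'_def)
      also have "\<dots> = (\<Sum>j\<in>G. T j (cball x r)) + (\<Sum>j\<in>G'. T j (cball x r))"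
        using fin by (intro sum.union_disjoint) (auto simp: G_def G'_def)
      also have "\<dots> \<le> ennreal (a * 6 ^ k * g r) + ennreal (H * V * E * g r)"
      proof (rule add_mono)
        have "(\<Sum>j\<in>G. T j (cball x r)) \<le> ennreal (a * g (6 * r))"
        proof (rule several)
          show "G \<subseteq> F" using nearF by (auto simp: G_def)
          show "big j \<subseteq> cball x (6 * r)" if "j \<in> G" for j
            using that FR[of j] nearF[of x r] r by (intro inball[of j x r]) (auto simp: G_def)
        qed (use r in auto)
        also have "\<dots> \<le> ennreal (a * 6 ^ k * g r)"
          using g_scale[OF r, of 6] a by (intro ennreal_leI) (auto simp: k_def mult.assoc)
        finally show "(\<Sum>j\<in>G. T j (cball x r)) \<le> ennreal (a * 6 ^ k * g r)" .
      next
        \<comment> \<open>two disjoint large balls of radius above \<open>4 * r\<close> have centres too far apart for both small balls to meet a ball of radius \<open>r\<close>\<close>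
        have eq: "i = j" if "i \<in> G'" "j \<in> G'" for i j
        proof (rule ccontr)
          assume "i \<noteq> j"
          have ij: "i \<in> F" "j \<in> F" "i \<in> near x r" "j \<in> near x r"
            using that nearF by (auto simp: G'_def)
          then have dis: "disjnt (big i) (big j)"
            using F(3) \<open>i \<noteq> j\<close> by (auto simp: pairwise_def big_def)
          have "snd i \<in> big i" "snd j \<in> big j" using FR ij by (auto simp: big_def less_imp_le)
          then have "snd j \<notin> big i" "snd i \<notin> big j" using dis by (auto simp: disjnt_def)
          then have "R (fst i) < dist (snd i) (snd j)" "R (fst j) < dist (snd i) (snd j)"
            by (auto simp: big_def dist_commute)
          moreover have "dist (snd i) (snd j) \<le> 2 * r + \<rho> (fst i) + \<rho> (fst j)"
            using centre[OF ij(3)] centre[OF ij(4)] dist_triangle2[of "snd i" "snd j" x]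
            by (simp add: dist_commute)
          moreover have "4 * r < R (fst i)" "4 * r < R (fst j)" using that by (auto simp: G'_def)
          ultimately show False using FR(1)[OF ij(1)] FR(1)[OF ij(2)] r by linarith
        qed
        show "(\<Sum>j\<in>G'. T j (cball x r)) \<le> ennreal (H * V * E * g r)"
        proof (cases "G' = {}")
          case False
          then obtain j where j: "j \<in> G'" by blast
          then have "G' = {j}" using eq by blast
          moreover have "j \<in> F" using j nearF by (auto simp: G'_def)
          ultimately show ?thesis using single r by simp
        qed simp
      qed
      also have "\<dots> = ennreal (B * g r)"
        using a g_pos[OF r] H0 V E_pos
        by (subst ennreal_plus[symmetric]) (auto simp: B_def algebra_simps)
      finally show ?thesis .
    qed
    have large: "mass h' (cball x r) \<le> ennreal (\<kappa> * a * g r)" if r: "\<delta> \<le> r" for x r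
    proof -
      have r0: "0 < r" using \<delta> r by simp
      have "mass h' (cball x r) \<le> ennreal (a * g (r + 2 * \<delta>1))"
        unfolding mass_near
      proof (rule several)
        show "big j \<subseteq> cball x (r + 2 * \<delta>1)" if "j \<in> near x r" for j
        proof -
          have "j \<in> F" using nearF that by blast
          then show ?thesis
            using FR[of j] \<rho>0[of "fst j"] by (intro inball[OF that]) auto
        qed
      qed (use r0 \<delta>1 nearF in auto)
      also have "\<dots> \<le> ennreal (\<kappa> * a * g r)"
      proof (rule ennreal_leI)
        have "2 * \<delta>1 = \<delta> * (root k \<kappa> - 1)" by (simp add: \<delta>1_def)
        also have "\<dots> \<le> r * (root k \<kappa> - 1)" using r \<open>1 < root k \<kappa>\<close> by (intro mult_right_mono) auto
        finally have "r + 2 * \<delta>1 \<le> root k \<kappa> * r" by (simp add: algebra_simps)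
        then have "g (r + 2 * \<delta>1) \<le> g (root k \<kappa> * r)" using r0 \<delta>1 by (intro g_mono) auto
        also have "\<dots> \<le> root k \<kappa> ^ k * g r"
          unfolding k_def using r0 \<open>1 < root k \<kappa>\<close> by (intro g_scale) (auto simp: k_def)
        also have "root k \<kappa> ^ k = \<kappa>" using k \<kappa> by simp
        finally show "a * g (r + 2 * \<delta>1) \<le> \<kappa> * a * g r" using a by (simp add: mult.commute mult.left_commute)
      qed
      finally show ?thesis .
    qed
    have hm': "h' \<in> borel_measurable borel"
      unfolding h'_def small_def
      by (intro borel_measurable_sum borel_measurable_times borel_measurable_const
        borel_measurable_indicator) auto
    have h'0: "0 \<le> h' x" for x unfolding h'_def using w0 by (intro sum_nonneg) auto
    define H' where "H' = (\<Sum>j\<in>F. w j)"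
    have H'0: "0 \<le> H'" unfolding H'_def using w0 by (intro sum_nonneg) auto
    have h'H: "h' x \<le> H'" for x
      unfolding h'_def H'_def using w0 by (intro sum_mono) (auto simp: indicator_def)
    obtain s0 where s0: "0 < s0" "\<And>r. 0 < r \<Longrightarrow> r \<le> s0 \<Longrightarrow> (H' * V / (\<kappa> * a)) * r ^ k \<le> g r"
      using g_dominates[of "H' * V / (\<kappa> * a)"] unfolding k_def by blast
    define s where "s = min s0 (\<delta> / 2)"
    have small_r: "mass h' (cball x r) \<le> ennreal (\<kappa> * a * g r)" if r: "0 < r" "r \<le> s" for x r
    proof -
      have "mass h' (cball x r) \<le> ennreal (H' * V * r ^ k)"
        unfolding V_def k_def using hm' h'H H'0 r by (intro mass_cball_le) auto
      also have "\<dots> \<le> ennreal (\<kappa> * a * g r)"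
        using s0(2)[of r] r a \<kappa> by (intro ennreal_leI) (auto simp: s_def field_simps)
      finally show ?thesis .
    qed
    have total: "mass h UNIV \<le> ennreal \<kappa> * mass h' UNIV"
    proof -
      have "mass h' UNIV = (\<Sum>j\<in>F. mass h (big j))"
        unfolding mass'[of UNIV, simplified] by (rule sum.cong) (auto simp: Tfull)
      also have "\<dots> = mass h (\<Union>j\<in>F. big j)"
        unfolding mass_def using F(1) disj by (intro sum_emeasure) (auto simp: big_borel)
      finally show ?thesis using F(4) by (simp add: big_def)
    qed
    have "bounded_density (\<Union>(q, c)\<in>F. ball c (\<rho> q)) h'"
      unfolding bounded_density_def
    proof (intro conjI allI impI exI)
      fix x assume "x \<notin> (\<Union>(q, c)\<in>F. ball c (\<rho> q))"
      then have "x \<notin> small j" if "j \<in> F" for j using that by (auto simp: small_def)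
      then show "h' x = 0" by (simp add: h'_def)
    qed (use hm' h'0 h'H in auto)
    moreover have "q \<ge> Q \<and> c \<in> P q \<and> cball c (\<rho> q) \<subseteq> U" if "(q, c) \<in> F" for q c
    proof -
      have "cball c (\<rho> q) \<subseteq> cball c (R q)"
        using F(2)[OF that] \<rho>0[of q] by (intro subset_cball) auto
      then show ?thesis using F(2)[OF that] by auto
    qed
    ultimately have "layer Q U F h'" using F(1) by (auto simp: layer_def)
    then show ?thesis
      using total allr large small_r s0(1) \<delta> by (intro exI[of _ h'] exI[of _ F] exI[of _ s]) (auto simp: s_def)
  qed
  ultimately show ?thesis by (rule that)
qed

lemma layer_add:
  assumes "layer Q U F h" "layer Q U F' h'"
  shows "layer Q U (F \<union> F') (\<lambda>x. h x + h' x)"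
proof -
  obtain H H' where H: "\<And>x. h x \<le> H" "\<And>x. h' x \<le> H'"
    using assms by (auto simp: layer_def bounded_density_def)
  then have "\<exists>H. \<forall>x. h x + h' x \<le> H" by (intro exI[of _ "H + H'"]) (simp add: add_mono)
  then show ?thesis using assms unfolding layer_def bounded_density_def by auto
qed

lemma layer_cmult:
  assumes "layer Q U F h" "0 \<le> c"
  shows "layer Q U F (\<lambda>x. c * h x)"
proof -
  obtain H where H: "\<And>x. h x \<le> H" using assms by (auto simp: layer_def bounded_density_def)
  then have "\<exists>H. \<forall>x. c * h x \<le> H"
    using assms(2) by (intro exI[of _ "c * H"]) (simp add: mult_left_mono)
  then show ?thesis using assms unfolding layer_def bounded_density_def by auto
qed

lemma layerD:
  assumes "layer Q U F h"
  shows "h \<in> borel_measurable borel" "0 \<le> h x"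
  using assms by (auto simp: layer_def bounded_density_def)

text \<open>Averaging many redistributions with disjoint ranges of critical scales removes the constant \<open>B\<close>: at
  every radius at most one of them violates the good bound.\<close>

lemma spread:
  assumes U: "open U" "U \<subseteq> U\<^sub>0" and h: "bounded_density U h"
    and a: "0 < a" and frostman: "\<And>x r. 0 < r \<Longrightarrow> mass h (cball x r) \<le> ennreal (a * g r)"
    and \<kappa>: "1 < \<kappa>"
  obtains h' F where "layer Q U F h'" "mass h UNIV \<le> ennreal \<kappa> * mass h' UNIV"
    "\<And>x r. 0 < r \<Longrightarrow> mass h' (cball x r) \<le> ennreal (\<kappa> * a * g r)"
proof -
  obtain \<mu> where \<mu>: "1 < \<mu>" "\<mu> < \<kappa>" using dense[OF \<kappa>] by blast
  obtain B where B: "0 \<le> B"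
    "\<And>Q \<delta>. 0 < \<delta> \<Longrightarrow> \<exists>h' F s. 0 < s \<and> s < \<delta> \<and> layer Q U F h' \<and>
        mass h UNIV \<le> ennreal \<mu> * mass h' UNIV \<and>
        (\<forall>x r. 0 < r \<longrightarrow> mass h' (cball x r) \<le> ennreal (B * g r)) \<and>
        (\<forall>x r. 0 < r \<longrightarrow> r \<le> s \<or> \<delta> \<le> r \<longrightarrow> mass h' (cball x r) \<le> ennreal (\<mu> * a * g r))"
    by (rule concentrate[OF U h a frostman \<mu>(1)], assumption) (rule that; assumption)
  \<comment> \<open>sums of \<open>N\<close> redistributions; the scale \<open>s\<close> returned at one stage is the \<open>\<delta>\<close> of the next\<close>
  have "\<exists>h' F s. 0 < s \<and> layer Q U F h' \<and>
      ennreal (real N) * mass h UNIV \<le> ennreal \<mu> * mass h' UNIV \<and>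
      (\<forall>x r. 0 < r \<longrightarrow> mass h' (cball x r) \<le> ennreal ((real N * (\<mu> * a) + B) * g r)) \<and>
      (\<forall>x r. 0 < r \<longrightarrow> r \<le> s \<longrightarrow> mass h' (cball x r) \<le> ennreal (real N * (\<mu> * a) * g r))" for N
  proof (induction N)
    case 0
    have "layer Q U {} (\<lambda>x. 0)" by (auto simp: layer_def bounded_density_def)
    then show ?case
      by (intro exI[of _ "\<lambda>x. 0"] exI[of _ "{}"] exI[of _ 1]) (auto simp: mass_eq)
  next
    case (Suc N)
    then obtain h1 F1 \<delta> where 1: "0 < \<delta>" "layer Q U F1 h1"
      "ennreal (real N) * mass h UNIV \<le> ennreal \<mu> * mass h1 UNIV"
      "\<And>x r. 0 < r \<Longrightarrow> mass h1 (cball x r) \<le> ennreal ((real N * (\<mu> * a) + B) * g r)"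
      "\<And>x r. 0 < r \<Longrightarrow> r \<le> \<delta> \<Longrightarrow> mass h1 (cball x r) \<le> ennreal (real N * (\<mu> * a) * g r)"
      by blast
    obtain h2 F2 s where 2: "0 < s" "s < \<delta>" "layer Q U F2 h2"
      "mass h UNIV \<le> ennreal \<mu> * mass h2 UNIV"
      "\<And>x r. 0 < r \<Longrightarrow> mass h2 (cball x r) \<le> ennreal (B * g r)"
      "\<And>x r. 0 < r \<Longrightarrow> r \<le> s \<or> \<delta> \<le> r \<Longrightarrow> mass h2 (cball x r) \<le> ennreal (\<mu> * a * g r)"
      using B(2)[OF 1(1), of Q] by blast
    define h' where "h' x = h1 x + h2 x" for x
    have mass': "mass h' A = mass h1 A + mass h2 A" if "A \<in> sets borel" for A
      unfolding h'_def using layerD[OF 1(2)] layerD[OF 2(3)] that by (intro mass_add) auto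
    have add: "mass h' (cball x r) \<le> ennreal (u + v)"
      if "mass h1 (cball x r) \<le> ennreal u" "mass h2 (cball x r) \<le> ennreal v" "0 \<le> u" "0 \<le> v" for x r u v
      using add_mono[OF that(1,2)] that(3,4) by (simp add: mass')
    have "layer Q U (F1 \<union> F2) h'" unfolding h'_def by (rule layer_add[OF 1(2) 2(3)])
    moreover have "ennreal (real (Suc N)) * mass h UNIV \<le> ennreal \<mu> * mass h' UNIV"
    proof -
      have "ennreal (real (Suc N)) * mass h UNIV = ennreal (real N) * mass h UNIV + mass h UNIV"
        by (simp add: ennreal_plus[symmetric] distrib_right add.commute del: ennreal_plus)
           (simp add: distrib_right add.commute)
      also have "\<dots> \<le> ennreal \<mu> * mass h1 UNIV + ennreal \<mu> * mass h2 UNIV"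
        using 1(3) 2(4) by (rule add_mono)
      also have "\<dots> = ennreal \<mu> * mass h' UNIV" by (simp add: mass' distrib_left)
      finally show ?thesis .
    qed
    moreover have "mass h' (cball x r) \<le> ennreal ((real (Suc N) * (\<mu> * a) + B) * g r)" if r: "0 < r" for x r
    proof (cases "r \<le> \<delta>")
      case True
      have "mass h' (cball x r) \<le> ennreal (real N * (\<mu> * a) * g r + B * g r)"
        using 1(5)[OF r True] 2(5)[OF r] g_pos[OF r] \<mu> a B(1) by (intro add) auto
      also have "\<dots> \<le> ennreal ((real (Suc N) * (\<mu> * a) + B) * g r)"
        using g_pos[OF r] \<mu> a by (intro ennreal_leI) (auto simp: algebra_simps)
      finally show ?thesis .
    next
      case False
      have "mass h' (cball x r) \<le> ennreal ((real N * (\<mu> * a) + B) * g r + \<mu> * a * g r)"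
        using 1(4)[OF r] 2(6)[OF r] False g_pos[OF r] \<mu> a B(1) by (intro add) auto
      then show ?thesis by (simp add: algebra_simps)
    qed
    moreover have "mass h' (cball x r) \<le> ennreal (real (Suc N) * (\<mu> * a) * g r)"
      if r: "0 < r" "r \<le> s" for x r
    proof -
      have "mass h' (cball x r) \<le> ennreal (real N * (\<mu> * a) * g r + \<mu> * a * g r)"
        using 1(5)[OF r(1)] 2(6)[OF r(1)] r 2(2) g_pos[OF r(1)] \<mu> a by (intro add) auto
      then show ?thesis by (simp add: algebra_simps)
    qed
    ultimately show ?case using 2(1) by blast
  qed
  note layers = this
  \<comment> \<open>\<open>N\<close> so large that \<open>B / N\<close> fits between \<open>\<mu> * a\<close> and \<open>\<kappa> * a\<close>\<close>
  obtain N :: nat where N: "B / ((\<kappa> - \<mu>) * a) < real N" using reals_Archimedean2 by blast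
  have "0 \<le> B / ((\<kappa> - \<mu>) * a)" using B(1) \<mu> a by simp
  then have N0: "0 < real N" using N by linarith
  have NB: "real N * (\<mu> * a) + B \<le> real N * (\<kappa> * a)"
    using N \<mu> a by (simp add: pos_divide_less_eq algebra_simps)
  obtain h1 F where 1: "layer Q U F h1"
      "ennreal (real N) * mass h UNIV \<le> ennreal \<mu> * mass h1 UNIV"
      "\<And>x r. 0 < r \<Longrightarrow> mass h1 (cball x r) \<le> ennreal ((real N * (\<mu> * a) + B) * g r)"
    using layers[of N] by blast
  define h' where "h' x = (1 / real N) * h1 x" for x
  have mass': "mass h' A = ennreal (1 / real N) * mass h1 A" if "A \<in> sets borel" for A
    unfolding h'_def using layerD[OF 1(1)] that by (intro mass_cmult) auto
  have "layer Q U F h'" unfolding h'_def by (rule layer_cmult[OF 1(1)]) simp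
  moreover have "mass h UNIV \<le> ennreal \<kappa> * mass h' UNIV"
  proof -
    have "mass h UNIV = ennreal (1 / real N) * (ennreal (real N) * mass h UNIV)"
      using N0 by (simp add: mult.assoc[symmetric] ennreal_mult'[symmetric])
    also have "\<dots> \<le> ennreal (1 / real N) * (ennreal \<kappa> * mass h1 UNIV)"
      using order_trans[OF 1(2) mult_right_mono[OF ennreal_leI[of \<mu> \<kappa>]]] \<mu>
      by (intro mult_left_mono) auto
    also have "\<dots> = ennreal \<kappa> * mass h' UNIV" by (simp add: mass' mult.left_commute)
    finally show ?thesis .
  qed
  moreover have "mass h' (cball x r) \<le> ennreal (\<kappa> * a * g r)" if r: "0 < r" for x r
  proof -
    have "mass h' (cball x r) \<le> ennreal (1 / real N) * ennreal ((real N * (\<mu> * a) + B) * g r)"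
      using 1(3)[OF r] by (simp add: mass' mult_left_mono)
    also have "\<dots> = ennreal (1 / real N * ((real N * (\<mu> * a) + B) * g r))"
      by (simp add: ennreal_mult'[symmetric])
    also have "\<dots> \<le> ennreal (1 / real N * (real N * (\<kappa> * a) * g r))"
      using NB g_pos[OF r] by (intro ennreal_leI mult_left_mono mult_right_mono) auto
    also have "1 / real N * (real N * (\<kappa> * a) * g r) = \<kappa> * a * g r" using N0 by simp
    finally show ?thesis .
  qed
  ultimately show ?thesis by (rule that)
qed

text \<open>Iteration of \<open>spread\<close>. The losses are controlled by the increasing sequence
  \<open>a n = 2 - 1 / 2 ^ n\<close>: both the constant in the bound and the reciprocal of the proportion of mass kept stay
  below \<open>2\<close>.\<close>

lemma nested_layers:
  assumes L: "0 < L" "\<And>r. 0 < r \<Longrightarrow> L * r ^ DIM('a) \<le> g r"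
  obtains h :: "nat \<Rightarrow> 'a \<Rightarrow> real" and K :: "nat \<Rightarrow> 'a set" where
    "\<And>n. compact (K n)" "\<And>n. K (Suc n) \<subseteq> K n" "K 0 \<subseteq> U\<^sub>0"
    "\<And>n x. x \<in> K n \<Longrightarrow> \<exists>q\<ge>n. \<exists>c\<in>P q. x \<in> cball c (\<rho> q)"
    "\<And>n. bounded_density (K n) (h n)"
    "\<And>n x r. 0 < r \<Longrightarrow> mass (h n) (cball x r) \<le> ennreal (2 * g r)"
    "\<And>n. ennreal (L / unit_ball_vol (real DIM('a))) * emeasure lborel U\<^sub>0 \<le> 2 * mass (h n) UNIV"
proof -
  define V where "V = unit_ball_vol (real DIM('a))"
  have V: "0 < V" by (simp add: V_def)
  define m where "m = ennreal (L / V) * emeasure lborel U\<^sub>0"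
  define a :: "nat \<Rightarrow> real" where "a n = 2 - 1 / 2 ^ n" for n
  have a: "1 \<le> a n" "a n < a (Suc n)" "a n \<le> 2" for n
    by (auto simp: a_def field_simps)
  define good where "good n = (\<lambda>(h, U). open U \<and> U \<subseteq> U\<^sub>0 \<and> bounded_density U h \<and>
      (\<forall>x r. 0 < r \<longrightarrow> mass h (cball x r) \<le> ennreal (a n * g r)) \<and> m \<le> ennreal (a n) * mass h UNIV)" for n
  define succ where "succ n = (\<lambda>(h :: 'a \<Rightarrow> real, U) (h', U'). \<exists>F. layer n U F h' \<and> U' = (\<Union>(q, c)\<in>F. ball c (\<rho> q)))" for n
  have "\<exists>X. \<forall>n. good n (X n) \<and> succ n (X n) (X (Suc n))"
  proof (rule dependent_nat_choice)
    define h where "h x = (L / V) * indicator U\<^sub>0 x" for x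
    have U0b: "U\<^sub>0 \<in> sets borel" using open_U0 by simp
    have hm: "h \<in> borel_measurable borel" unfolding h_def using U0b by simp
    have hH: "h x \<le> L / V" for x using L V by (auto simp: h_def indicator_def)
    have h0: "0 \<le> h x" for x using L V by (auto simp: h_def indicator_def)
    have bd: "bounded_density U\<^sub>0 h"
      unfolding bounded_density_def using hm hH h0 by (auto simp: h_def)
    have fr: "mass h (cball x r) \<le> ennreal (1 * g r)" if r: "0 < r" for x r
    proof -
      have "mass h (cball x r) \<le> ennreal (L / V * V * r ^ DIM('a))"
        unfolding V_def using hm hH L V r by (intro mass_cball_le) (auto simp: V_def)
      also have "\<dots> \<le> ennreal (1 * g r)" using V L(2)[OF r] by (intro ennreal_leI) auto
      finally show ?thesis .
    qed
    have tot: "m \<le> mass h UNIV"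
    proof -
      have "mass h UNIV = (\<integral>\<^sup>+x. ennreal (L / V) * indicator U\<^sub>0 x \<partial>lborel)"
        using hm by (subst mass_eq) (auto simp: h_def indicator_def intro!: nn_integral_cong)
      also have "\<dots> = m" using U0b by (simp add: nn_integral_cmult_indicator m_def)
      finally show ?thesis by simp
    qed
    have a0: "a 0 = 1" by (simp add: a_def)
    have "good 0 (h, U\<^sub>0)"
      using bd fr tot open_U0 unfolding good_def a0 by simp
    then show "\<exists>X. good 0 X" ..
  next
    fix X n assume X: "good n X"
    obtain h U where hU: "X = (h, U)" by (rule prod.exhaust)
    have U: "open U" "U \<subseteq> U\<^sub>0" "bounded_density U h"
      "\<And>x r. 0 < r \<Longrightarrow> mass h (cball x r) \<le> ennreal (a n * g r)" "m \<le> ennreal (a n) * mass h UNIV"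
      using X unfolding hU good_def by auto
    define \<kappa> where "\<kappa> = a (Suc n) / a n"
    have an: "0 < a n" using a(1)[of n] by simp
    have \<kappa>: "1 < \<kappa>" "\<kappa> * a n = a (Suc n)" using a(2)[of n] an by (auto simp: \<kappa>_def)
    obtain h' F where 1: "layer n U F h'" "mass h UNIV \<le> ennreal \<kappa> * mass h' UNIV"
        "\<And>x r. 0 < r \<Longrightarrow> mass h' (cball x r) \<le> ennreal (\<kappa> * a n * g r)"
      by (rule spread[OF U(1-3) an U(4) \<kappa>(1), where Q = n], assumption) (rule that; assumption)
    define U' where "U' = (\<Union>(q, c)\<in>F. ball c (\<rho> q))"
    have "U' \<subseteq> U"
      using 1(1) ball_subset_cball unfolding layer_def U'_def by fastforce
    moreover have "open U'" unfolding U'_def by auto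
    moreover have "bounded_density U' h'" using 1(1) by (simp add: layer_def U'_def)
    moreover have "m \<le> ennreal (a (Suc n)) * mass h' UNIV"
    proof -
      have "m \<le> ennreal (a n) * (ennreal \<kappa> * mass h' UNIV)"
        by (rule order_trans[OF U(5) mult_left_mono[OF 1(2)]]) simp
      also have "\<dots> = ennreal (a (Suc n)) * mass h' UNIV"
        unfolding \<kappa>(2)[symmetric] using an \<kappa>(1) by (simp add: ennreal_mult mult.assoc mult.left_commute)
      finally show ?thesis .
    qed
    ultimately have "good (Suc n) (h', U')"
      unfolding good_def using U(2) 1(3) unfolding \<kappa>(2) by auto
    moreover have "succ n X (h', U')" using 1(1) by (auto simp: succ_def hU U'_def)
    ultimately show "\<exists>Y. good (Suc n) Y \<and> succ n X Y" by blast
  qed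
  then obtain X where X: "\<And>n. good n (X n)" "\<And>n. succ n (X n) (X (Suc n))" by blast
  have "\<exists>F. layer n (snd (X n)) F (fst (X (Suc n))) \<and> snd (X (Suc n)) = (\<Union>(q, c)\<in>F. ball c (\<rho> q))" for n
    using X(2)[of n] by (auto simp: succ_def split: prod.splits)
  then obtain F where F: "\<And>n. layer n (snd (X n)) (F n) (fst (X (Suc n)))"
      "\<And>n. snd (X (Suc n)) = (\<Union>(q, c)\<in>F n. ball c (\<rho> q))" by metis
  define K where "K n = (\<Union>(q, c)\<in>F n. cball c (\<rho> q))" for n
  have KU: "K n \<subseteq> snd (X n)" for n
    using F(1)[of n] by (fastforce simp: layer_def K_def)
  have UK: "snd (X (Suc n)) \<subseteq> K n" for n
    unfolding F(2) K_def using ball_subset_cball by fastforce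
  have goodD: "snd (X n) \<subseteq> U\<^sub>0" "bounded_density (snd (X n)) (fst (X n))"
    "0 < r \<Longrightarrow> mass (fst (X n)) (cball x r) \<le> ennreal (a n * g r)"
    "m \<le> ennreal (a n) * mass (fst (X n)) UNIV" for n x r
    using X(1)[of n] by (auto simp: good_def split: prod.splits)
  show ?thesis
  proof (rule that[of K "\<lambda>n. fst (X (Suc n))"])
    show "compact (K n)" for n
      unfolding K_def using F(1)[of n] by (intro compact_UN) (auto simp: layer_def)
    show "K (Suc n) \<subseteq> K n" for n using KU[of "Suc n"] UK[of n] by blast
    show "K 0 \<subseteq> U\<^sub>0" using KU[of 0] goodD(1)[of 0] by blast
    show "\<exists>q\<ge>n. \<exists>c\<in>P q. x \<in> cball c (\<rho> q)" if "x \<in> K n" for n x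
      using that F(1)[of n] by (fastforce simp: K_def layer_def)
    show "bounded_density (K n) (fst (X (Suc n)))" for n
      using goodD(2)[of "Suc n"] UK[of n] unfolding bounded_density_def by blast
    show "mass (fst (X (Suc n))) (cball x r) \<le> ennreal (2 * g r)" if r: "0 < r" for n x r
    proof -
      have "a (Suc n) * g r \<le> 2 * g r" using a(3) g_pos[OF r] by (intro mult_right_mono) auto
      then show ?thesis using goodD(3)[OF r, of "Suc n" x] ennreal_leI order_trans by blast
    qed
    show "ennreal (L / unit_ball_vol (real DIM('a))) * emeasure lborel U\<^sub>0 \<le> 2 * mass (fst (X (Suc n))) UNIV" for n
    proof -
      have "ennreal (a (Suc n)) * mass (fst (X (Suc n))) UNIV \<le> ennreal 2 * mass (fst (X (Suc n))) UNIV"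
        by (intro mult_right_mono ennreal_leI a(3)) auto
      then show ?thesis using goodD(4)[of "Suc n"] by (simp add: m_def V_def)
    qed
  qed
qed

text \<open>The mass distribution argument. A point lying in every \<open>K n\<close> is in the limsup set, so by compactness some
  \<open>K n\<close> is already covered by finitely many of the given balls with doubled radii.\<close>

theorem cover_bound:
  assumes L: "0 < L" "\<And>r. 0 < r \<Longrightarrow> L * r ^ DIM('a) \<le> g r"
    and r: "\<And>i. i \<in> I \<Longrightarrow> 0 < r i"
    and cover: "{x \<in> U\<^sub>0. infinite {q. \<exists>c\<in>P q. x \<in> cball c (\<rho> q)}} \<subseteq> (\<Union>i\<in>I. cball (c i) (r i))"
  shows "ennreal (L / unit_ball_vol (real DIM('a))) * emeasure lborel U\<^sub>0
           \<le> ennreal (2 ^ (DIM('a) + 2)) * (\<Sum>\<^sub>\<infinity>i\<in>I. ennreal (g (r i)))"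
proof -
  obtain h :: "nat \<Rightarrow> 'a \<Rightarrow> real" and K :: "nat \<Rightarrow> 'a set" where
    K: "\<And>n. compact (K n)" "\<And>n. K (Suc n) \<subseteq> K n" "K 0 \<subseteq> U\<^sub>0"
      "\<And>n x. x \<in> K n \<Longrightarrow> \<exists>q\<ge>n. \<exists>c\<in>P q. x \<in> cball c (\<rho> q)"
    and h: "\<And>n. bounded_density (K n) (h n)"
      "\<And>n x r. 0 < r \<Longrightarrow> mass (h n) (cball x r) \<le> ennreal (2 * g r)"
      "\<And>n. ennreal (L / unit_ball_vol (real DIM('a))) * emeasure lborel U\<^sub>0 \<le> 2 * mass (h n) UNIV"
    by (rule nested_layers[OF L], assumption) (rule that; assumption)
  define O' where "O' = (\<Union>i\<in>I. ball (c i) (2 * r i))"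
  have Kdec: "K n \<subseteq> K m" if "m \<le> n" for m n
    using lift_Suc_antimono_le[of K, OF K(2) that] .
  have "\<exists>n. K n - O' = {}"
  proof (rule ccontr)
    assume ne: "\<nexists>n. K n - O' = {}"
    have "\<Inter>(range (\<lambda>n. K n - O')) \<noteq> {}"
    proof (rule compact_nest)
      show "compact (K n - O')" for n
        by (intro compact_diff K(1)) (auto simp: O'_def)
    qed (use ne Kdec in blast)+
    then obtain x where x: "\<And>n. x \<in> K n" "x \<notin> O'" by blast
    have "infinite {q. \<exists>c\<in>P q. x \<in> cball c (\<rho> q)}"
      unfolding infinite_nat_iff_unbounded_le using K(4)[OF x(1)] by blast
    then have "x \<in> (\<Union>i\<in>I. cball (c i) (r i))" using cover K(3) x(1)[of 0] by blast
    moreover have "cball (c i) (r i) \<subseteq> ball (c i) (2 * r i)" if "i \<in> I" for i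
      using r[OF that] by (auto simp: subset_iff)
    ultimately show False using x(2) unfolding O'_def by blast
  qed
  then obtain n where "K n \<subseteq> (\<Union>i\<in>I. ball (c i) (2 * r i))" by (auto simp: O'_def)
  then obtain J where J: "J \<subseteq> I" "finite J" "K n \<subseteq> (\<Union>i\<in>J. ball (c i) (2 * r i))"
    using compactE_image[OF K(1)[of n], of I "\<lambda>i. ball (c i) (2 * r i)"] by blast
  have "mass (h n) UNIV = mass (h n) (K n)"
    using mass_support[OF h(1)[of n]] K(1)[of n] by (simp add: borel_compact)
  also have "\<dots> \<le> mass (h n) (\<Union>i\<in>J. cball (c i) (2 * r i))"
  proof (rule mass_mono)
    have "(\<Union>i\<in>J. ball (c i) (2 * r i)) \<subseteq> (\<Union>i\<in>J. cball (c i) (2 * r i))"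
      by (intro UN_mono order_refl ball_subset_cball)
    then show "K n \<subseteq> (\<Union>i\<in>J. cball (c i) (2 * r i))" using J(3) by blast
    show "(\<Union>i\<in>J. cball (c i) (2 * r i)) \<in> sets borel" using J(2) by (intro sets.finite_UN) auto
  qed
  also have "\<dots> \<le> (\<Sum>i\<in>J. mass (h n) (cball (c i) (2 * r i)))"
    unfolding mass_def using J(2) by (intro emeasure_subadditive_finite) auto
  also have "\<dots> \<le> (\<Sum>i\<in>J. ennreal (2 ^ (DIM('a) + 1)) * ennreal (g (r i)))"
  proof (rule sum_mono)
    fix i assume "i \<in> J"
    then have ri: "0 < r i" using J r by blast
    have "mass (h n) (cball (c i) (2 * r i)) \<le> ennreal (2 * g (2 * r i))"
      using ri by (intro h(2)) auto
    also have "\<dots> \<le> ennreal (2 ^ (DIM('a) + 1) * g (r i))"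
      using g_scale[OF ri, of 2] by (intro ennreal_leI) auto
    finally show "mass (h n) (cball (c i) (2 * r i)) \<le> ennreal (2 ^ (DIM('a) + 1)) * ennreal (g (r i))"
      using g_pos[OF ri] by (simp add: ennreal_mult'[symmetric])
  qed
  also have "\<dots> = ennreal (2 ^ (DIM('a) + 1)) * (\<Sum>i\<in>J. ennreal (g (r i)))"
    by (simp add: sum_distrib_left)
  also have "\<dots> \<le> ennreal (2 ^ (DIM('a) + 1)) * (\<Sum>\<^sub>\<infinity>i\<in>I. ennreal (g (r i)))"
    using J(1,2)
    by (intro mult_left_mono) (auto simp: nonneg_infsum_complete intro!: SUP_upper)
  finally have "2 * mass (h n) UNIV \<le> 2 * (ennreal (2 ^ (DIM('a) + 1)) * (\<Sum>\<^sub>\<infinity>i\<in>I. ennreal (g (r i))))"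
    by (rule mult_left_mono) auto
  also have "\<dots> = ennreal (2 ^ (DIM('a) + 2)) * (\<Sum>\<^sub>\<infinity>i\<in>I. ennreal (g (r i)))"
  proof -
    have "(2 :: ennreal) * ennreal (2 ^ (DIM('a) + 1)) = ennreal (2 ^ (DIM('a) + 2))"
      by (simp add: ennreal_mult[symmetric] ennreal_numeral[symmetric] del: ennreal_numeral)
    then show ?thesis by (simp add: mult.assoc[symmetric])
  qed
  finally show ?thesis using h(3)[of n] order_trans by blast
qed

end

section \<open>Hausdorff measures\<close>

lemma premeasure_mono: "A \<subseteq> B \<Longrightarrow> hausdorff_premeasure f \<rho> A \<le> hausdorff_premeasure f \<rho> B"
  unfolding hausdorff_premeasure_def by (intro Inf_superset_mono) blast

lemma hausdorff_measure_mono: "A \<subseteq> B \<Longrightarrow> hausdorff_measure f A \<le> hausdorff_measure f B"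
  unfolding hausdorff_measure_def by (intro SUP_mono) (blast intro: premeasure_mono)

lemma infsum_ennreal_le:
  fixes F :: "'b \<Rightarrow> ennreal"
  assumes "\<And>J. finite J \<Longrightarrow> J \<subseteq> I \<Longrightarrow> sum F J \<le> b"
  shows "infsum F I \<le> b"
  using assms by (subst nonneg_infsum_complete) (auto intro: SUP_least)

lemma sum_le_infsum_ennreal:
  fixes F :: "'b \<Rightarrow> ennreal"
  assumes "finite J" "J \<subseteq> I"
  shows "sum F J \<le> infsum F I"
  using assms by (subst nonneg_infsum_complete) (auto intro: SUP_upper)

lemma premeasure_le_countable:
  fixes c :: "'j \<Rightarrow> real ^ 'k"
  assumes J: "countable J" and r: "\<And>j. j \<in> J \<Longrightarrow> 0 < r j \<and> r j \<le> \<rho>"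
    and cover: "F \<subseteq> (\<Union>j\<in>J. cball (c j) (r j))"
  shows "hausdorff_premeasure f \<rho> F \<le> (\<Sum>\<^sub>\<infinity>j\<in>J. ennreal (f (r j)))"
proof -
  define e where "e = to_nat_on J"
  define d where "d = from_nat_into J"
  have de: "d (e j) = j" if "j \<in> J" for j using that J by (simp add: d_def e_def)
  have inj: "inj_on e J" unfolding e_def by (rule inj_on_to_nat_on[OF J])
  have "(\<Sum>\<^sub>\<infinity>i\<in>e ` J. ennreal (f (r (d i)))) = (\<Sum>\<^sub>\<infinity>j\<in>J. ennreal (f (r j)))"
    unfolding infsum_reindex[OF inj] by (intro infsum_cong) (simp add: de)
  moreover have "hausdorff_premeasure f \<rho> F \<le> (\<Sum>\<^sub>\<infinity>i\<in>e ` J. ennreal (f (r (d i))))"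
    unfolding hausdorff_premeasure_def
  proof (rule Inf_lower, rule CollectI, intro exI conjI)
    show "(\<Sum>\<^sub>\<infinity>i\<in>e ` J. ennreal (f (r (d i)))) = (\<Sum>\<^sub>\<infinity>i\<in>e ` J. ennreal (f ((r \<circ> d) i)))" by simp
    show "\<forall>i\<in>e ` J. 0 < (r \<circ> d) i \<and> (r \<circ> d) i \<le> \<rho>" using r by (auto simp: de)
    show "F \<subseteq> (\<Union>i\<in>e ` J. cball ((c \<circ> d) i) ((r \<circ> d) i))" using cover by (fastforce simp: de)
  qed
  ultimately show ?thesis by simp
qed

lemma premeasure_Un_null:
  assumes null: "hausdorff_premeasure f \<rho> N = 0"
  shows "hausdorff_premeasure f \<rho> (A \<union> N) \<le> hausdorff_premeasure f \<rho> A"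
  unfolding hausdorff_premeasure_def[of f \<rho> A]
proof (rule Inf_greatest, clarify)
  fix I :: "nat set" and c :: "nat \<Rightarrow> real ^ 'a" and r :: "nat \<Rightarrow> real"
  assume r: "\<forall>i\<in>I. 0 < r i \<and> r i \<le> \<rho>" and A: "A \<subseteq> (\<Union>i\<in>I. cball (c i) (r i))"
  show "hausdorff_premeasure f \<rho> (A \<union> N) \<le> (\<Sum>\<^sub>\<infinity>i\<in>I. ennreal (f (r i)))"
  proof (rule ennreal_le_epsilon)
    fix e :: real assume "0 < e"
    then have "hausdorff_premeasure f \<rho> N < ennreal e" using null by simp
    then obtain I' :: "nat set" and c' r' where N: "(\<Sum>\<^sub>\<infinity>i\<in>I'. ennreal (f (r' i))) < ennreal e"
        "\<forall>i\<in>I'. 0 < r' i \<and> r' i \<le> \<rho>" "N \<subseteq> (\<Union>i\<in>I'. cball (c' i) (r' i))"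
      unfolding hausdorff_premeasure_def Inf_less_iff by blast
    define C where "C = case_sum c c'"
    define R where "R = case_sum r r'"
    have "hausdorff_premeasure f \<rho> (A \<union> N) \<le> (\<Sum>\<^sub>\<infinity>j\<in>I <+> I'. ennreal (f (R j)))"
    proof (rule premeasure_le_countable)
      show "A \<union> N \<subseteq> (\<Union>j\<in>I <+> I'. cball (C j) (R j))"
      proof
        fix x assume "x \<in> A \<union> N"
        then consider i where "i \<in> I" "x \<in> cball (c i) (r i)" | i where "i \<in> I'" "x \<in> cball (c' i) (r' i)"
          using A N(3) by blast
        then show "x \<in> (\<Union>j\<in>I <+> I'. cball (C j) (R j))"
        proof cases
          case 1 then show ?thesis by (intro UN_I[of "Inl i"]) (auto simp: C_def R_def)
        next
          case 2 then show ?thesis by (intro UN_I[of "Inr i"]) (auto simp: C_def R_def)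
        qed
      qed
      show "0 < R j \<and> R j \<le> \<rho>" if "j \<in> I <+> I'" for j
        using that r N(2) by (auto simp: R_def)
      show "countable (I <+> I')" by (rule countable_Plus) (rule countableI_type)+
    qed
    also have "\<dots> = (\<Sum>\<^sub>\<infinity>j\<in>Inl ` I. ennreal (f (R j))) + (\<Sum>\<^sub>\<infinity>j\<in>Inr ` I'. ennreal (f (R j)))"
      unfolding Plus_def by (intro infsum_Un_disjoint nonneg_summable_on_complete) auto
    also have "(\<Sum>\<^sub>\<infinity>j\<in>Inl ` I. ennreal (f (R j))) = (\<Sum>\<^sub>\<infinity>i\<in>I. ennreal (f (r i)))"
      by (subst infsum_reindex) (auto simp: R_def o_def)
    also have "(\<Sum>\<^sub>\<infinity>j\<in>Inr ` I'. ennreal (f (R j))) = (\<Sum>\<^sub>\<infinity>i\<in>I'. ennreal (f (r' i)))"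
      by (subst infsum_reindex) (auto simp: R_def o_def)
    also have "(\<Sum>\<^sub>\<infinity>i\<in>I. ennreal (f (r i))) + (\<Sum>\<^sub>\<infinity>i\<in>I'. ennreal (f (r' i)))
        \<le> (\<Sum>\<^sub>\<infinity>i\<in>I. ennreal (f (r i))) + ennreal e"
      using N(1) by (intro add_left_mono) simp
    finally show "hausdorff_premeasure f \<rho> (A \<union> N) \<le> (\<Sum>\<^sub>\<infinity>i\<in>I. ennreal (f (r i))) + ennreal e" .
  qed
qed

text \<open>A null set lies in an open set of small volume. Disjoint balls inside it have small total volume, and enlarged
  five times they cover the null set.\<close>

lemma premeasure_negligible:
  fixes N :: "(real ^ 'k) set"
  assumes N: "negligible N" and \<rho>: "0 < \<rho>" and A: "0 < A" and s: "0 < s"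
    and f: "\<And>r. 0 < r \<Longrightarrow> r \<le> s \<Longrightarrow> f r \<le> A * r ^ CARD('k)"
  shows "hausdorff_premeasure f \<rho> N = 0"
proof -
  define V where "V = unit_ball_vol (real CARD('k))"
  have V: "0 < V" by (simp add: V_def)
  have vol: "emeasure lebesgue (cball x r) = ennreal (V * r ^ CARD('k))" if "0 \<le> r" for x :: "real ^ 'k" and r
    using emeasure_cball[OF that, of x] by (simp add: V_def)
  have "hausdorff_premeasure f \<rho> N \<le> ennreal e" if e: "0 < e" for e
  proof -
    define A' where "A' = A * 5 ^ CARD('k)"
    have A': "0 < A'" using A by (simp add: A'_def)
    define \<epsilon> where "\<epsilon> = e * V / A'"
    have \<epsilon>: "0 < \<epsilon>" using e V A' by (simp add: \<epsilon>_def)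
    have Nnull: "N \<in> null_sets lebesgue" using N by (simp add: negligible_iff_null_sets)
    obtain T where T: "open T" "N \<subseteq> T" "T - N \<in> lmeasurable" "emeasure lebesgue (T - N) < ennreal \<epsilon>"
      by (rule sets_lebesgue_outer_open[OF null_setsD2[OF Nnull] \<epsilon>]) (rule that; assumption)
    have "emeasure lebesgue T \<le> emeasure lebesgue ((T - N) \<union> N)"
      using sets.Un[OF fmeasurableD[OF T(3)] null_setsD2[OF Nnull]] by (intro emeasure_mono) auto
    also have "\<dots> \<le> emeasure lebesgue (T - N) + emeasure lebesgue N"
      by (rule emeasure_subadditive[OF fmeasurableD[OF T(3)] null_setsD2[OF Nnull]])
    finally have Tvol: "emeasure lebesgue T \<le> ennreal \<epsilon>"
      using T(4) null_setsD1[OF Nnull] by (simp del: emeasure_completion)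
    have "\<exists>r. 0 < r \<and> r \<le> min \<rho> s / 5 \<and> cball x r \<subseteq> T" if "x \<in> N" for x
    proof -
      obtain d where "0 < d" "cball x d \<subseteq> T" using T(1,2) \<open>x \<in> N\<close> open_contains_cball by blast
      then show ?thesis using \<rho> s
        by (intro exI[of _ "min d (min \<rho> s / 5)"]) (auto simp: subset_iff)
    qed
    then obtain R where R: "\<And>x. x \<in> N \<Longrightarrow> 0 < R x \<and> R x \<le> min \<rho> s / 5 \<and> cball x (R x) \<subseteq> T" by metis
    have N1: "N \<subseteq> (\<Union>x\<in>N. cball x (R x))" using R by (force simp: less_imp_le)
    have N2: "\<And>x. x \<in> N \<Longrightarrow> 0 < R x \<and> R x \<le> min \<rho> s / 5" using R by blast
    obtain C where C: "countable C" "C \<subseteq> N"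
        "pairwise (\<lambda>i j. disjnt (cball i (R i)) (cball j (R j))) C" "N \<subseteq> (\<Union>i\<in>C. cball i (5 * R i))"
      by (rule Vitali_covering_lemma_cballs[OF N1 N2], assumption) (rule that; assumption)
    have "hausdorff_premeasure f \<rho> N \<le> (\<Sum>\<^sub>\<infinity>i\<in>C. ennreal (f (5 * R i)))"
    proof (rule premeasure_le_countable[where c = "\<lambda>i. i"])
      show "0 < 5 * R i \<and> 5 * R i \<le> \<rho>" if "i \<in> C" for i
        using R[of i] that C(2) by auto
    qed (use C in auto)
    also have "\<dots> \<le> ennreal e"
    proof (rule infsum_ennreal_le)
      fix J assume J: "finite J" "J \<subseteq> C"
      have RJ: "0 < R i" "R i \<le> s / 5" if "i \<in> J" for i
        using that J C(2) R[of i] by auto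
      have "ennreal (\<Sum>i\<in>J. V * R i ^ CARD('k)) = (\<Sum>i\<in>J. emeasure lebesgue (cball i (R i)))"
        using RJ V
        by (subst sum_ennreal[symmetric])
           (auto simp: vol less_imp_le simp del: emeasure_completion intro!: sum.cong)
      also have "\<dots> = emeasure lebesgue (\<Union>i\<in>J. cball i (R i))"
        using J pairwise_subset[OF C(3) J(2)]
        by (intro sum_emeasure) (auto simp: disjoint_family_on_def pairwise_def disjnt_def)
      also have "\<dots> \<le> emeasure lebesgue T"
        using J C(2) R T(1) by (intro emeasure_mono) (auto simp: subset_iff)
      finally have "ennreal (\<Sum>i\<in>J. V * R i ^ CARD('k)) \<le> ennreal \<epsilon>" using Tvol by simp
      then have *: "(\<Sum>i\<in>J. V * R i ^ CARD('k)) \<le> \<epsilon>" using \<epsilon> by (simp add: ennreal_le_iff)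
      have "(\<Sum>i\<in>J. ennreal (f (5 * R i))) \<le> (\<Sum>i\<in>J. ennreal (A' / V * (V * R i ^ CARD('k))))"
      proof (rule sum_mono, rule ennreal_leI)
        fix i assume "i \<in> J"
        then have "f (5 * R i) \<le> A * (5 * R i) ^ CARD('k)" using RJ[of i] by (intro f) auto
        then show "f (5 * R i) \<le> A' / V * (V * R i ^ CARD('k))"
          using V by (simp add: A'_def power_mult_distrib)
      qed
      also have "\<dots> = ennreal (A' / V * (\<Sum>i\<in>J. V * R i ^ CARD('k)))"
        using RJ V A' by (subst sum_ennreal) (auto simp: sum_distrib_left less_imp_le)
      also have "\<dots> \<le> ennreal (A' / V * \<epsilon>)" using * V A' by (intro ennreal_leI mult_left_mono) auto
      also have "A' / V * \<epsilon> = e" using V A' by (simp add: \<epsilon>_def)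
      finally show "(\<Sum>i\<in>J. ennreal (f (5 * R i))) \<le> ennreal e" .
    qed
    finally show ?thesis .
  qed
  then have "hausdorff_premeasure f \<rho> N \<le> 0" by - (rule ennreal_le_epsilon, simp)
  then show ?thesis by simp
qed

lemma hausdorff_measure_infinite:
  assumes "0 < c" "\<And>L. 0 < L \<Longrightarrow> \<exists>\<rho>>0. ennreal (L * c) \<le> hausdorff_premeasure f \<rho> S"
  shows "hausdorff_measure f S = \<infinity>"
proof (rule ccontr)
  assume "hausdorff_measure f S \<noteq> \<infinity>"
  then obtain b where b: "hausdorff_measure f S = ennreal b" "0 \<le> b" by (cases "hausdorff_measure f S") auto
  have "(b + 1) / c * c = b + 1" using assms(1) by simp
  then obtain \<rho> where \<rho>: "0 < \<rho>" "ennreal (b + 1) \<le> hausdorff_premeasure f \<rho> S"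
    using assms(2)[of "(b + 1) / c"] assms(1) b(2) by fastforce
  note \<rho>(2)
  also have "hausdorff_premeasure f \<rho> S \<le> hausdorff_measure f S"
    unfolding hausdorff_measure_def using \<rho>(1) by (intro SUP_upper) auto
  finally have "ennreal (b + 1) \<le> ennreal b" unfolding b(1) .
  then show False using b(2) by (simp add: ennreal_le_iff)
qed

lemma volume_le_premeasure:
  fixes S :: "(real ^ 'k) set"
  assumes L: "0 < L" and f: "\<And>r. 0 < r \<Longrightarrow> r \<le> \<rho> \<Longrightarrow> L * r ^ CARD('k) \<le> f r"
  shows "ennreal (L / unit_ball_vol (real CARD('k))) * emeasure lebesgue S \<le> hausdorff_premeasure f \<rho> S"
  unfolding hausdorff_premeasure_def
proof (rule Inf_greatest, clarify)
  define V where "V = unit_ball_vol (real CARD('k))"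
  have V: "0 < V" by (simp add: V_def)
  have vol: "emeasure lebesgue (cball x r) = ennreal (V * r ^ CARD('k))" if "0 \<le> r" for x :: "real ^ 'k" and r
    using emeasure_cball[OF that, of x] by (simp add: V_def)
  fix I :: "nat set" and c :: "nat \<Rightarrow> real ^ 'k" and r :: "nat \<Rightarrow> real"
  assume r: "\<forall>i\<in>I. 0 < r i \<and> r i \<le> \<rho>" and S: "S \<subseteq> (\<Union>i\<in>I. cball (c i) (r i))"
  define B where "B i = (if i \<in> I then cball (c i) (r i) else {})" for i
  have Bs: "B i \<in> sets lebesgue" for i by (simp add: B_def)
  have "ennreal (L / V) * emeasure lebesgue S \<le> ennreal (L / V) * (\<Sum>i. emeasure lebesgue (B i))"
  proof (rule mult_left_mono)
    have "emeasure lebesgue S \<le> emeasure lebesgue (\<Union>i. B i)"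
      using S Bs by (intro emeasure_mono) (auto simp: B_def subset_iff split: if_splits)
    also have "\<dots> \<le> (\<Sum>i. emeasure lebesgue (B i))"
      using Bs by (intro emeasure_subadditive_countably) auto
    finally show "emeasure lebesgue S \<le> (\<Sum>i. emeasure lebesgue (B i))" .
  qed simp
  also have "\<dots> = (\<Sum>i. ennreal (L / V) * emeasure lebesgue (B i))" by simp
  also have "\<dots> \<le> (\<Sum>\<^sub>\<infinity>i\<in>I. ennreal (f (r i)))"
  proof (rule suminf_le_const)
    fix n
    have "(\<Sum>i<n. ennreal (L / V) * emeasure lebesgue (B i))
        = (\<Sum>i\<in>{..<n} \<inter> I. ennreal (L / V) * emeasure lebesgue (B i))"
      by (intro sum.mono_neutral_right) (auto simp: B_def)
    also have "\<dots> \<le> (\<Sum>i\<in>{..<n} \<inter> I. ennreal (f (r i)))"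
    proof (rule sum_mono)
      fix i assume "i \<in> {..<n} \<inter> I"
      then have i: "i \<in> I" "0 < r i" "r i \<le> \<rho>" using r by auto
      have "ennreal (L / V) * emeasure lebesgue (B i) = ennreal (L / V * (V * r i ^ CARD('k)))"
        using i L V by (subst ennreal_mult) (auto simp: B_def vol simp del: emeasure_completion)
      also have "\<dots> \<le> ennreal (f (r i))" using f[OF i(2,3)] V by (intro ennreal_leI) auto
      finally show "ennreal (L / V) * emeasure lebesgue (B i) \<le> ennreal (f (r i))" .
    qed
    also have "\<dots> \<le> (\<Sum>\<^sub>\<infinity>i\<in>I. ennreal (f (r i)))" by (intro sum_le_infsum_ennreal) auto
    finally show "(\<Sum>i<n. ennreal (L / V) * emeasure lebesgue (B i)) \<le> (\<Sum>\<^sub>\<infinity>i\<in>I. ennreal (f (r i)))" .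
  qed simp
  finally show "ennreal (L / unit_ball_vol (real CARD('k))) * emeasure lebesgue S \<le> (\<Sum>\<^sub>\<infinity>i\<in>I. ennreal (f (r i)))"
    by (simp add: V_def)
qed

text \<open>The mass transference principle: if the large balls cover almost every point of \<open>U\<close> infinitely often, then
  the limsup set of the small balls has infinite Hausdorff \<open>f\<close>-measure in \<open>U\<close>.\<close>

lemma hausdorff_measure_mass_transference:
  fixes P :: "nat \<Rightarrow> (real ^ 'k) set"
  assumes pos: "\<And>r. 0 < r \<Longrightarrow> 0 < f r" and mono: "\<And>r s. 0 < r \<Longrightarrow> r \<le> s \<Longrightarrow> f r \<le> f s"
    and scale: "\<And>r t. 0 < r \<Longrightarrow> 1 \<le> t \<Longrightarrow> f (t * r) \<le> t ^ CARD('k) * f r"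
    and dom: "\<And>A. \<exists>s>0. \<forall>r. 0 < r \<longrightarrow> r \<le> s \<longrightarrow> A * r ^ CARD('k) \<le> f r"
    and \<rho>: "\<And>q. 0 < \<rho> q" "\<forall>\<^sub>F q in sequentially. 8 * \<rho> q \<le> R q"
    and R: "R \<longlonglongrightarrow> 0" "\<And>q. R q ^ CARD('k) \<le> E * f (\<rho> q)" and E: "0 < E"
    and U: "open U" "bounded U" "U \<noteq> {}"
    and abundant: "negligible {x \<in> U. finite {q. \<exists>c\<in>P q. x \<in> cball c (R q)}}"
  shows "hausdorff_measure f {x \<in> U. infinite {q. \<exists>c\<in>P q. x \<in> cball c (\<rho> q)}} = \<infinity>" (is "hausdorff_measure f ?S = _")
proof -
  define V where "V = unit_ball_vol (real CARD('k))"
  have V: "0 < V" by (simp add: V_def)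
  have Ufin: "emeasure lborel U < \<infinity>" using emeasure_bounded_finite[OF U(2)] by simp
  obtain v where v: "emeasure lborel U = ennreal v" "0 \<le> v"
    using Ufin by (cases "emeasure lborel U") auto
  have "emeasure lborel U \<noteq> 0"
  proof
    assume "emeasure lborel U = 0"
    then have "U \<in> null_sets lborel" using U(1) by auto
    then have "negligible U"
      by (simp add: negligible_iff_null_sets null_sets_completionI)
    then show False using open_not_negligible[OF U(1,3)] by blast
  qed
  with v have v0: "0 < v" by (cases "v = 0") auto
  define M where "M = (2::real) ^ (CARD('k) + 3)"
  have M: "0 < M" by (simp add: M_def)
  show ?thesis
  proof (rule hausdorff_measure_infinite)
    show "0 < v / V / M" using v0 V M by simp
    fix L :: real assume L: "0 < L"
    \<comment> \<open>below some scale \<open>f \<le> g \<le> 2 * f\<close>, while the initial mass is a fixed multiple of \<open>L\<close>\<close>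
    define g where "g r = f r + L * r ^ CARD('k)" for r
    have fg: "f r \<le> g r" if "0 < r" for r using L that by (simp add: g_def)
    interpret mass_transference g P \<rho> R E U
    proof
      show "0 < g r" if "0 < r" for r using pos[OF that] fg[OF that] by simp
      show "g r \<le> g s" if "0 < r" "r \<le> s" for r s
        using mono[OF that] that L by (auto simp: g_def intro!: add_mono power_mono)
      show "g (t * r) \<le> t ^ DIM(real ^ 'k) * g r" if "0 < r" "1 \<le> t" for r t
        using scale[OF that] by (simp add: g_def power_mult_distrib algebra_simps)
      show "\<exists>s>0. \<forall>r. 0 < r \<longrightarrow> r \<le> s \<longrightarrow> A * r ^ DIM(real ^ 'k) \<le> g r" for A
        using dom[of A] fg by (auto intro: order_trans)
      show "R q ^ DIM(real ^ 'k) \<le> E * g (\<rho> q)" for q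
      proof -
        have "E * f (\<rho> q) \<le> E * g (\<rho> q)" using fg[OF \<rho>(1)] E by (intro mult_left_mono) auto
        then show ?thesis using R(2)[of q] by simp
      qed
    qed (use \<rho> R(1) E U abundant in auto)
    obtain s where s: "0 < s" "\<And>r. 0 < r \<Longrightarrow> r \<le> s \<Longrightarrow> L * r ^ CARD('k) \<le> f r"
      using dom[of L] by blast
    have "ennreal (L * (v / V / M)) \<le> hausdorff_premeasure f s ?S"
      unfolding hausdorff_premeasure_def
    proof (rule Inf_greatest, clarify)
      fix I :: "nat set" and c :: "nat \<Rightarrow> real ^ 'k" and r :: "nat \<Rightarrow> real"
      assume r: "\<forall>i\<in>I. 0 < r i \<and> r i \<le> s" and cov: "?S \<subseteq> (\<Union>i\<in>I. cball (c i) (r i))"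
      define T where "T = (\<Sum>\<^sub>\<infinity>i\<in>I. ennreal (f (r i)))"
      have gT: "(\<Sum>\<^sub>\<infinity>i\<in>I. ennreal (g (r i))) \<le> 2 * T"
      proof (rule infsum_ennreal_le)
        fix J assume J: "finite J" "J \<subseteq> I"
        have "(\<Sum>i\<in>J. ennreal (g (r i))) \<le> (\<Sum>i\<in>J. 2 * ennreal (f (r i)))"
        proof (rule sum_mono)
          fix i assume "i \<in> J"
          then have i: "0 < r i" "r i \<le> s" using r J by auto
          have "ennreal (g (r i)) \<le> ennreal (2 * f (r i))"
            using s(2)[OF i] by (intro ennreal_leI) (simp add: g_def)
          then show "ennreal (g (r i)) \<le> 2 * ennreal (f (r i))"
            using pos[OF i(1)] by (simp add: ennreal_mult)
        qed
        also have "\<dots> = 2 * (\<Sum>i\<in>J. ennreal (f (r i)))" by (simp add: sum_distrib_left)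
        also have "\<dots> \<le> 2 * T"
          unfolding T_def using J by (intro mult_left_mono sum_le_infsum_ennreal) auto
        finally show "(\<Sum>i\<in>J. ennreal (g (r i))) \<le> 2 * T" .
      qed
      have "ennreal (L / V) * emeasure lborel U
          \<le> ennreal (2 ^ (CARD('k) + 2)) * (\<Sum>\<^sub>\<infinity>i\<in>I. ennreal (g (r i)))"
        using cover_bound[of L I r c] L r cov pos by (simp add: V_def g_def less_imp_le)
      also have "\<dots> \<le> ennreal (2 ^ (CARD('k) + 2)) * (2 * T)" by (intro mult_left_mono gT) auto
      also have "\<dots> = ennreal M * T"
      proof -
        have "ennreal (2 ^ (CARD('k) + 2)) * 2 = ennreal M"
          by (simp add: M_def ennreal_mult'[symmetric] ennreal_numeral[symmetric] power_add del: ennreal_numeral)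
        then show ?thesis by (simp add: mult.assoc[symmetric])
      qed
      finally have *: "ennreal (L / V * v) \<le> ennreal M * T"
        unfolding v(1) using L V v(2) by (subst ennreal_mult) auto
      have "ennreal (L * (v / V / M)) = ennreal (1 / M) * ennreal (L / V * v)"
        using M by (simp add: ennreal_mult'[symmetric] mult.commute)
      also have "\<dots> \<le> ennreal (1 / M) * (ennreal M * T)" by (intro mult_left_mono *) auto
      also have "\<dots> = T" using M by (simp add: mult.assoc[symmetric] ennreal_mult'[symmetric])
      finally show "ennreal (L * (v / V / M)) \<le> (\<Sum>\<^sub>\<infinity>i\<in>I. ennreal (f (r i)))" by (simp add: T_def)
    qed
    then show "\<exists>\<rho>>0. ennreal (L * (v / V / M)) \<le> hausdorff_premeasure f \<rho> ?S" using s(1) by blast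
  qed
qed

section \<open>Simultaneous approximation by reduced fractions\<close>

lemma finite_int_vectors_near:
  fixes y :: "real ^ 'k"
  assumes "1 \<le> q"
  shows "finite {p :: int ^ 'k. \<forall>i. \<bar>y $ i - of_int (p $ i) / real q\<bar> < t}"
proof -
  define S where "S i = {\<lfloor>real q * (y $ i - t)\<rfloor> .. \<lceil>real q * (y $ i + t)\<rceil>}" for i
  have "p $ i \<in> S i" if "\<bar>y $ i - of_int (p $ i) / real q\<bar> < t" for p :: "int ^ 'k" and i
  proof -
    have "y $ i - t < of_int (p $ i) / real q" "of_int (p $ i) / real q < y $ i + t"
      using that by (auto simp: abs_less_iff)
    then have "real q * (y $ i - t) < of_int (p $ i)" "of_int (p $ i) < real q * (y $ i + t)"
      using assms by (auto simp: field_simps)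
    then show ?thesis unfolding S_def by (simp add: floor_le_iff le_ceiling_iff)
  qed
  then have "{p :: int ^ 'k. \<forall>i. \<bar>y $ i - of_int (p $ i) / real q\<bar> < t}
      \<subseteq> vec_lambda ` (\<Pi>\<^sub>E i\<in>UNIV. S i)"
    by (intro subsetI) (rule image_eqI[of _ _ "vec_nth _"], auto)
  moreover have "finite (vec_lambda ` (\<Pi>\<^sub>E i\<in>UNIV. S i))"
    by (intro finite_imageI finite_PiE) (auto simp: S_def)
  ultimately show ?thesis by (rule finite_subset)
qed

text \<open>Each denominator admits only finitely many numerators, so infinitely many pairs amount to infinitely many
  denominators. Denominators are written \<open>Suc n\<close>.\<close>

lemma mem_duffin_schaeffer_set_iff:
  fixes y :: "real ^ 'k"
  shows "y \<in> duffin_schaeffer_set \<psi> \<longleftrightarrow> y \<in> cbox 0 1 \<and>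
    infinite {n. \<exists>p :: int ^ 'k. \<forall>i. \<bar>y $ i - of_int (p $ i) / real (Suc n)\<bar> < \<psi> (real (Suc n)) / real (Suc n) \<and>
       gcd (p $ i) (int (Suc n)) = 1}"
proof -
  define A where "A = {(q :: nat, p :: int ^ 'k). q \<ge> 1 \<and>
          (\<forall>i. \<bar>y $ i - of_int (p $ i) / real q\<bar> < \<psi> (real q) / real q \<and> gcd (p $ i) (int q) = 1)}"
  have "finite A" if "finite (fst ` A)"
  proof -
    have "A \<subseteq> Sigma (fst ` A \<inter> {1..}) (\<lambda>q. {p. \<forall>i. \<bar>y $ i - of_int (p $ i) / real q\<bar> < \<psi> (real q) / real q})"
      by (force simp: A_def)
    moreover have "finite \<dots>" using that by (intro finite_SigmaI finite_int_vectors_near) auto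
    ultimately show ?thesis by (rule finite_subset)
  qed
  then have 1: "finite A \<longleftrightarrow> finite (fst ` A)" by blast
  have "fst ` A = Suc ` {n. \<exists>p :: int ^ 'k. \<forall>i. \<bar>y $ i - of_int (p $ i) / real (Suc n)\<bar> < \<psi> (real (Suc n)) / real (Suc n) \<and>
       gcd (p $ i) (int (Suc n)) = 1}" (is "_ = Suc ` ?B")
  proof (intro equalityI subsetI)
    fix q assume "q \<in> fst ` A"
    then obtain p where p: "(q, p) \<in> A" by auto
    then obtain n where n: "q = Suc n" by (cases q) (auto simp: A_def)
    then have "n \<in> ?B" using p unfolding A_def by blast
    then show "q \<in> Suc ` ?B" using n by blast
  next
    fix q assume "q \<in> Suc ` ?B"
    then obtain n p where "q = Suc n" "(Suc n, p) \<in> A" unfolding A_def by auto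
    then show "q \<in> fst ` A" by force
  qed
  then have "finite (fst ` A) \<longleftrightarrow> finite ?B" by (simp add: finite_image_iff)
  with 1 have "finite A \<longleftrightarrow> finite ?B" by blast
  then show ?thesis unfolding duffin_schaeffer_set_def mem_Collect_eq A_def[symmetric] by blast
qed

lemma duffin_schaeffer_set_subset: "duffin_schaeffer_set \<psi> \<subseteq> cbox 0 1"
  by (auto simp: duffin_schaeffer_set_def)

lemma negligible_cube_diff:
  fixes S :: "(real ^ 'k) set"
  assumes S: "S \<subseteq> cbox 0 1" "emeasure lebesgue S = 1"
  shows "negligible (cbox 0 1 - S)"
proof -
  have Sm: "S \<in> sets lebesgue" using S(2) emeasure_notin_sets[of S lebesgue] by force
  have "measure lborel (cbox 0 (1 :: real ^ 'k)) = 1"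
    by (subst content_cbox_cart) (auto simp: interval_ne_empty_cart)
  then have "emeasure lebesgue (cbox 0 (1 :: real ^ 'k)) = 1"
    using emeasure_eq_ennreal_measure[of lborel "cbox 0 (1 :: real ^ 'k)"]
      emeasure_lborel_cbox_finite[of 0 "1 :: real ^ 'k"] by simp
  then have "emeasure lebesgue (cbox 0 1 - S) = 0"
    using emeasure_Diff[of lebesgue S "cbox 0 1"] S Sm by (simp del: emeasure_completion)
  then show ?thesis
    using Sm by (auto simp: negligible_iff_null_sets null_sets_def simp del: emeasure_completion)
qed

lemma suminf_ennreal_eq_infinity_iff:
  assumes "\<And>n. 0 \<le> x n"
  shows "(\<Sum>n. ennreal (x n)) = \<infinity> \<longleftrightarrow> \<not> summable x"
proof
  assume "(\<Sum>n. ennreal (x n)) = \<infinity>"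
  then show "\<not> summable x" using suminf_ennreal2[OF assms] by auto
next
  assume "\<not> summable x"
  then show "(\<Sum>n. ennreal (x n)) = \<infinity>"
    by (rule contrapos_np) (use summable_suminf_not_top[of x] assms in simp)
qed

lemma tendsto_zero_of_summable_power:
  fixes x c :: "nat \<Rightarrow> real"
  assumes k: "0 < k" and x: "\<And>n. 0 \<le> x n" and c: "\<And>n. 1 \<le> c n"
    and summable: "summable (\<lambda>n. (c n * x n) ^ k)"
  shows "x \<longlonglongrightarrow> 0"
proof -
  have "(\<lambda>n. root k ((c n * x n) ^ k)) \<longlonglongrightarrow> root k 0"
    by (intro tendsto_real_root summable_LIMSEQ_zero[OF summable])
  moreover have nn: "0 \<le> c n * x n" for n using x[of n] c[of n] by simp
  ultimately have lim: "(\<lambda>n. c n * x n) \<longlonglongrightarrow> 0" using k by (simp add: real_root_power_cancel)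
  show ?thesis
  proof (rule tendsto_sandwich[OF _ _ tendsto_const lim])
    show "\<forall>\<^sub>F n in sequentially. 0 \<le> x n" using x by simp
    have "x n \<le> c n * x n" for n using mult_right_mono[OF c x, of n n] by simp
    then show "\<forall>\<^sub>F n in sequentially. x n \<le> c n * x n" by simp
  qed
qed

text \<open>The small balls are Euclidean balls of radius \<open>x n / 2\<close>, so that even the closed balls lie inside the open
  boxes defining the limsup set of \<open>\<psi>\<close>; the large balls contain the boxes of half side
  \<open>root CARD('k) (f (x n))\<close>, because the Euclidean norm is at most \<open>CARD('k)\<close> times the maximum norm.\<close>

lemma hausdorff_measure_duffin_schaeffer_infinite:
  fixes \<psi> f \<theta> :: "real \<Rightarrow> real"
  defines "x \<equiv> \<lambda>n. \<psi> (real (Suc n)) / real (Suc n)"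
  assumes \<psi>: "pos_fun \<psi>" and x0: "x \<longlonglongrightarrow> 0"
    and pos: "\<And>r. 0 < r \<Longrightarrow> 0 < f r" and mono: "\<And>r s. 0 < r \<Longrightarrow> r \<le> s \<Longrightarrow> f r \<le> f s"
    and scale: "\<And>r t. 0 < r \<Longrightarrow> 1 \<le> t \<Longrightarrow> f (t * r) \<le> t ^ CARD('k) * f r"
    and dom: "\<And>A. \<exists>s>0. \<forall>r. 0 < r \<longrightarrow> r \<le> s \<longrightarrow> A * r ^ CARD('k) \<le> f r"
    and f0: "(f \<longlongrightarrow> 0) (at_right 0)"
    and \<theta>: "\<And>n. \<theta> (real (Suc n)) / real (Suc n) = root CARD('k) (f (x n))"
    and full: "emeasure lebesgue (duffin_schaeffer_set \<theta> :: (real ^ 'k) set) = 1"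
  shows "hausdorff_measure f (duffin_schaeffer_set \<psi> :: (real ^ 'k) set) = \<infinity>"
proof -
  define k where "k = CARD('k)"
  have k: "0 < k" by (simp add: k_def)
  have xpos: "0 < x n" for n using \<psi> by (simp add: x_def pos_fun_def)
  define P where "P n = {c :: real ^ 'k. \<exists>p :: int ^ 'k. \<forall>i. c $ i = of_int (p $ i) / real (Suc n) \<and> gcd (p $ i) (int (Suc n)) = 1}" for n
  define \<rho> where "\<rho> n = x n / 2" for n
  define R where "R n = real k * root k (f (x n))" for n
  define U where "U = box (0 :: real ^ 'k) 1"
  define S where "S = {y \<in> U. infinite {n. \<exists>c\<in>P n. y \<in> cball c (\<rho> n)}}"
  have fx0: "(\<lambda>n. f (x n)) \<longlonglongrightarrow> 0"
    by (rule filterlim_compose[OF f0]) (use x0 xpos less_imp_neq[OF xpos] in \<open>auto simp: filterlim_at\<close>)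
  have "hausdorff_measure f S = \<infinity>"
    unfolding S_def
  proof (rule hausdorff_measure_mass_transference[OF pos mono scale dom])
    show "0 < \<rho> n" for n using xpos by (simp add: \<rho>_def)
    obtain s where s: "0 < s" "\<And>r. 0 < r \<Longrightarrow> r \<le> s \<Longrightarrow> 4 ^ k * r ^ k \<le> f r"
      using dom[of "4 ^ k"] unfolding k_def by blast
    have "\<forall>\<^sub>F n in sequentially. x n < s" using x0 s(1) by (rule order_tendstoD)
    then show "\<forall>\<^sub>F n in sequentially. 8 * \<rho> n \<le> R n"
    proof eventually_elim
      case (elim n)
      have "(4 * x n) ^ k \<le> f (x n)" using s(2)[OF xpos, of n] elim by (simp add: power_mult_distrib)
      then have "root k ((4 * x n) ^ k) \<le> root k (f (x n))" using k by simp
      moreover have "root k ((4 * x n) ^ k) = 4 * x n"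
        using xpos[of n] by (intro real_root_power_cancel[OF k]) simp
      ultimately have "4 * x n \<le> root k (f (x n))" by simp
      also have "\<dots> \<le> R n"
        using mult_right_mono[of 1 "real k" "root k (f (x n))"] k pos[OF xpos[of n]] by (simp add: R_def)
      finally show ?case by (simp add: \<rho>_def)
    qed
    have "(\<lambda>n. root k (f (x n))) \<longlonglongrightarrow> root k 0" by (intro tendsto_real_root fx0)
    then show "R \<longlonglongrightarrow> 0" unfolding R_def by (intro tendsto_mult_right_zero) simp
    show "R n ^ CARD('k) \<le> (2 * real k) ^ k * f (\<rho> n)" for n
    proof -
      have "R n ^ CARD('k) = real k ^ k * f (x n)"
        using k pos[OF xpos[of n]] by (simp add: R_def k_def[symmetric] power_mult_distrib)
      also have "\<dots> \<le> real k ^ k * (2 ^ k * f (\<rho> n))"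
        using scale[of "\<rho> n" 2] xpos[of n] by (intro mult_left_mono) (auto simp: \<rho>_def k_def)
      finally show ?thesis by (simp add: power_mult_distrib mult_ac)
    qed
    show "0 < (2 * real k) ^ k" using k by simp
    show "open U" "bounded U" unfolding U_def by auto
    have "(\<chi> i. 1 / 2) \<in> U" by (simp add: U_def mem_box_cart)
    then show "U \<noteq> {}" by blast
    have "{y \<in> U. finite {n. \<exists>c\<in>P n. y \<in> cball c (R n)}} \<subseteq> cbox 0 1 - duffin_schaeffer_set \<theta>"
    proof (clarify, intro DiffI)
      fix y :: "real ^ 'k" assume y: "y \<in> U" and fin: "finite {n. \<exists>c\<in>P n. y \<in> cball c (R n)}"
      show "y \<in> cbox 0 1" using y box_subset_cbox unfolding U_def by blast
      show "y \<notin> duffin_schaeffer_set \<theta>"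
      proof
        assume "y \<in> duffin_schaeffer_set \<theta>"
        then have inf: "infinite {n. \<exists>p :: int ^ 'k. \<forall>i. \<bar>y $ i - of_int (p $ i) / real (Suc n)\<bar> < root CARD('k) (f (x n)) \<and>
           gcd (p $ i) (int (Suc n)) = 1}" (is "infinite ?B")
          unfolding mem_duffin_schaeffer_set_iff \<theta> by blast
        have "?B \<subseteq> {n. \<exists>c\<in>P n. y \<in> cball c (R n)}"
        proof clarify
          fix n and p :: "int ^ 'k"
          assume p: "\<forall>i. \<bar>y $ i - of_int (p $ i) / real (Suc n)\<bar> < root CARD('k) (f (x n)) \<and> gcd (p $ i) (int (Suc n)) = 1"
          define c :: "real ^ 'k" where "c = (\<chi> i. of_int (p $ i) / real (Suc n))"
          have "c \<in> P n" unfolding P_def using p by (auto simp: c_def)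
          moreover have "norm (y - c) \<le> (\<Sum>i\<in>UNIV. \<bar>(y - c) $ i\<bar>)" by (rule norm_le_l1_cart)
          moreover have "\<dots> \<le> of_nat (card (UNIV :: 'k set)) * root k (f (x n))"
            using p by (intro sum_bounded_above) (auto simp: c_def k_def less_imp_le)
          ultimately show "\<exists>c\<in>P n. y \<in> cball c (R n)"
            by (intro bexI[of _ c]) (auto simp: R_def k_def dist_norm norm_minus_commute)
        qed
        then show False using fin inf finite_subset by blast
      qed
    qed
    then show "negligible {y \<in> U. finite {n. \<exists>c\<in>P n. y \<in> cball c (R n)}}"
      using negligible_subset negligible_cube_diff[OF duffin_schaeffer_set_subset full] by blast
  qed
  moreover have "S \<subseteq> duffin_schaeffer_set \<psi>"
  proof
    fix y assume "y \<in> S"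
    then have y: "y \<in> cbox 0 1" "infinite {n. \<exists>c\<in>P n. y \<in> cball c (\<rho> n)}"
      using box_subset_cbox[of 0 "1 :: real ^ 'k"] by (auto simp: S_def U_def)
    have "{n. \<exists>c\<in>P n. y \<in> cball c (\<rho> n)} \<subseteq> {n. \<exists>p :: int ^ 'k. \<forall>i. \<bar>y $ i - of_int (p $ i) / real (Suc n)\<bar> < \<psi> (real (Suc n)) / real (Suc n) \<and>
           gcd (p $ i) (int (Suc n)) = 1}" (is "_ \<subseteq> ?B")
    proof clarify
      fix n c assume "c \<in> P n" and c: "y \<in> cball c (\<rho> n)"
      then obtain p :: "int ^ 'k" where p: "\<And>i. c $ i = of_int (p $ i) / real (Suc n)" "\<And>i. gcd (p $ i) (int (Suc n)) = 1"
        unfolding P_def by blast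
      have "\<bar>y $ i - of_int (p $ i) / real (Suc n)\<bar> < \<psi> (real (Suc n)) / real (Suc n)" for i
      proof -
        have "\<bar>(y - c) $ i\<bar> \<le> norm (y - c)" by (rule component_le_norm_cart)
        also have "\<dots> \<le> \<rho> n" using c by (simp add: dist_norm norm_minus_commute)
        also have "\<dots> < x n" using xpos[of n] by (simp add: \<rho>_def)
        finally show ?thesis by (simp add: p(1) x_def)
      qed
      then show "\<exists>p :: int ^ 'k. \<forall>i. \<bar>y $ i - of_int (p $ i) / real (Suc n)\<bar> < \<psi> (real (Suc n)) / real (Suc n) \<and>
           gcd (p $ i) (int (Suc n)) = 1" using p(2) by blast
    qed
    then have "infinite ?B" using y(2) finite_subset by blast
    then show "y \<in> duffin_schaeffer_set \<psi>" using y(1) unfolding mem_duffin_schaeffer_set_iff by blast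
  qed
  ultimately show ?thesis using hausdorff_measure_mono[of S "duffin_schaeffer_set \<psi>" f] by (simp add: top_unique)
qed

section \<open>From Lebesgue measure to Hausdorff measures\<close>

theorem theorem1:
  assumes "\<forall>\<psi>. pos_fun \<psi> \<longrightarrow>
    (\<Sum>n. ennreal ((real (totient (Suc n)) * \<psi> (real (Suc n)) / real (Suc n)) ^ CARD('k))) = \<infinity> \<longrightarrow>
    emeasure lebesgue (duffin_schaeffer_set \<psi> :: (real ^ 'k) set) = 1"
  shows "\<forall>\<psi> f. pos_fun \<psi> \<longrightarrow> dimension_function f \<longrightarrow>
    (mono_on {0<..} (\<lambda>r. f r / r ^ CARD('k)) \<or> antimono_on {0<..} (\<lambda>r. f r / r ^ CARD('k))) \<longrightarrow>
    (\<Sum>n. ennreal (f (\<psi> (real (Suc n)) / real (Suc n)) * real (totient (Suc n)) ^ CARD('k))) = \<infinity> \<longrightarrow>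
    hausdorff_measure f (duffin_schaeffer_set \<psi> :: (real ^ 'k) set) = hausdorff_measure f (cbox 0 (1 :: real ^ 'k))"
proof (intro allI impI)
  fix \<psi> f :: "real \<Rightarrow> real"
  assume \<psi>: "pos_fun \<psi>" and dim: "dimension_function f"
    and monotonic: "mono_on {0<..} (\<lambda>r. f r / r ^ CARD('k)) \<or> antimono_on {0<..} (\<lambda>r. f r / r ^ CARD('k))"
    and div: "(\<Sum>n. ennreal (f (\<psi> (real (Suc n)) / real (Suc n)) * real (totient (Suc n)) ^ CARD('k))) = \<infinity>"
  define k where "k = CARD('k)"
  have k: "0 < k" by (simp add: k_def)
  define x where "x n = \<psi> (real (Suc n)) / real (Suc n)" for n
  define t where "t n = real (totient (Suc n))" for n
  let ?S = "duffin_schaeffer_set \<psi> :: (real ^ 'k) set"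
  let ?Q = "cbox 0 1 :: (real ^ 'k) set"
  have xpos: "0 < x n" for n using \<psi> by (simp add: x_def pos_fun_def)
  have t1: "1 \<le> t n" for n by (simp add: t_def Suc_le_eq)
  have pos: "0 < f r" if "0 < r" for r using dim that by (simp add: dimension_function_def pos_fun_def)
  have mono: "f r \<le> f s" if "0 < r" "r \<le> s" for r s
    using dim that unfolding dimension_function_def by (auto elim!: mono_onD)
  have nsum: "\<not> summable (\<lambda>n. f (x n) * t n ^ k)"
    using div pos[OF xpos] t1 unfolding x_def[symmetric] t_def[symmetric] k_def[symmetric]
    by (subst (asm) suminf_ennreal_eq_infinity_iff) (auto intro!: mult_nonneg_nonneg simp: less_imp_le order_trans[OF zero_le_one])
  have conj1: "emeasure lebesgue (duffin_schaeffer_set \<theta> :: (real ^ 'k) set) = 1"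
    if "pos_fun \<theta>" "\<not> summable (\<lambda>n. (t n * (\<theta> (real (Suc n)) / real (Suc n))) ^ k)" for \<theta>
  proof -
    have "0 \<le> (t n * (\<theta> (real (Suc n)) / real (Suc n))) ^ k" for n
      using that(1) t1[of n] by (auto simp: pos_fun_def intro!: zero_le_power mult_nonneg_nonneg divide_nonneg_nonneg less_imp_le)
    from suminf_ennreal_eq_infinity_iff[of "\<lambda>n. (t n * (\<theta> (real (Suc n)) / real (Suc n))) ^ k", OF this] that(2)
    show ?thesis using assms that(1) by (simp add: t_def k_def)
  qed
  have full_S: "emeasure lebesgue ?S = 1" if "\<not> summable (\<lambda>n. (t n * x n) ^ k)"
    using conj1[OF \<psi>] that by (simp add: x_def)
  have Sle: "hausdorff_measure f ?S \<le> hausdorff_measure f ?Q"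
    by (rule hausdorff_measure_mono[OF duffin_schaeffer_set_subset])
  show "hausdorff_measure f ?S = hausdorff_measure f ?Q"
  proof (cases "\<exists>A>0. \<exists>s>0. \<forall>r. 0 < r \<longrightarrow> r \<le> s \<longrightarrow> f r \<le> A * r ^ k")
    case True
    then obtain A s where A: "0 < A" "0 < s" "\<And>r. 0 < r \<Longrightarrow> r \<le> s \<Longrightarrow> f r \<le> A * r ^ k" by blast
    have "\<not> summable (\<lambda>n. (t n * x n) ^ k)"
    proof
      assume sum: "summable (\<lambda>n. (t n * x n) ^ k)"
      have "x \<longlonglongrightarrow> 0"
        by (rule tendsto_zero_of_summable_power[OF k less_imp_le[OF xpos] t1 sum])
      then have "\<forall>\<^sub>F n in sequentially. x n < s" using A(2) by (rule order_tendstoD)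
      then have "\<forall>\<^sub>F n in sequentially. norm (f (x n) * t n ^ k) \<le> A * (t n * x n) ^ k"
      proof eventually_elim
        case (elim n)
        have "f (x n) * t n ^ k \<le> A * x n ^ k * t n ^ k"
          using A(3)[OF xpos] elim t1[of n] by (intro mult_right_mono) auto
        then show ?case using pos[OF xpos[of n]] t1[of n] by (simp add: power_mult_distrib mult_ac)
      qed
      then have "summable (\<lambda>n. f (x n) * t n ^ k)"
        by (rule summable_comparison_test_ev) (intro summable_mult sum)
      with nsum show False by simp
    qed
    then have N: "negligible (?Q - ?S)"
      using negligible_cube_diff[OF duffin_schaeffer_set_subset] full_S by blast
    have Q: "?Q = ?S \<union> (?Q - ?S)" using duffin_schaeffer_set_subset by blast
    have "hausdorff_premeasure f \<rho> ?Q \<le> hausdorff_premeasure f \<rho> ?S" if "0 < \<rho>" for \<rho>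
      by (subst Q, rule premeasure_Un_null, rule premeasure_negligible[OF N that A(1,2)])
         (use A(3) in \<open>simp add: k_def\<close>)
    then have "hausdorff_measure f ?Q \<le> hausdorff_measure f ?S"
      unfolding hausdorff_measure_def by (intro SUP_mono) auto
    then show ?thesis
      by (rule antisym[OF Sle])
  next
    case False
    then have large: "\<exists>r. 0 < r \<and> r \<le> s \<and> A * r ^ k < f r" if "0 < A" "0 < s" for A s
      using that by (meson not_le)
    \<comment> \<open>a nondecreasing quotient would be bounded near \<open>0\<close> by its value at \<open>1\<close>\<close>
    have "\<not> mono_on {0<..} (\<lambda>r. f r / r ^ k)"
    proof
      assume m: "mono_on {0<..} (\<lambda>r. f r / r ^ k)"
      obtain r where r: "0 < r" "r \<le> 1" "f 1 * r ^ k < f r" using large[of "f 1" 1] pos by auto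
      have "f r / r ^ k \<le> f 1 / 1 ^ k" by (rule mono_onD[OF m]) (use r in auto)
      then show False using r by (simp add: field_simps)
    qed
    then have "antimono_on {0<..} (\<lambda>r. f r / r ^ k)" using monotonic by (simp add: k_def)
    then have anti: "f s / s ^ k \<le> f r / r ^ k" if "0 < r" "r \<le> s" for r s
      using monotone_onD[of "{0<..}" "(\<le>)" "(\<ge>)" "\<lambda>r. f r / r ^ k" r s] that by simp
    have scale: "f (c * r) \<le> c ^ k * f r" if "0 < r" "1 \<le> c" for r c
      using anti[of r "c * r"] that by (simp add: power_mult_distrib field_simps)
    have dom: "\<exists>s>0. \<forall>r. 0 < r \<longrightarrow> r \<le> s \<longrightarrow> A * r ^ k \<le> f r" for A
    proof -
      obtain s where s: "0 < s" "max A 1 * s ^ k < f s" using large[of "max A 1" 1] by (auto simp: less_max_iff_disj)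
      have "A * r ^ k \<le> f r" if "0 < r" "r \<le> s" for r
      proof -
        have "A \<le> f s / s ^ k" using s by (simp add: pos_le_divide_eq) (smt (verit) mult_right_mono zero_less_power)
        also have "\<dots> \<le> f r / r ^ k" using anti that by blast
        finally show ?thesis using that by (simp add: field_simps)
      qed
      then show ?thesis using s(1) by blast
    qed
    have "hausdorff_measure f ?S = \<infinity>"
    proof (cases "x \<longlonglongrightarrow> 0")
      case False
      then have full: "emeasure lebesgue ?S = 1"
        using full_S tendsto_zero_of_summable_power[of k x t, OF k less_imp_le[OF xpos] t1] by blast
      show ?thesis
      proof (rule hausdorff_measure_infinite)
        show "0 < 1 / unit_ball_vol (real CARD('k))" by simp
        fix L :: real assume L: "0 < L"
        obtain s where "0 < s" "\<And>r. 0 < r \<Longrightarrow> r \<le> s \<Longrightarrow> L * r ^ CARD('k) \<le> f r"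
          using dom[of L] unfolding k_def by blast
        then show "\<exists>\<rho>>0. ennreal (L * (1 / unit_ball_vol (real CARD('k)))) \<le> hausdorff_premeasure f \<rho> ?S"
          using volume_le_premeasure[OF L, of s f ?S] full by (auto simp del: emeasure_completion)
      qed
    next
      case True
      \<comment> \<open>chosen so that the volume sum of \<open>\<theta>\<close> is the given divergent sum\<close>
      define \<theta> where "\<theta> y = y * root k (f (\<psi> y / y))" for y
      have \<theta>: "\<theta> (real (Suc n)) / real (Suc n) = root k (f (x n))" for n
        by (simp add: \<theta>_def x_def)
      have \<theta>_pos: "pos_fun \<theta>"
        unfolding pos_fun_def
      proof (intro allI impI)
        fix y :: real assume "0 < y"
        then have "0 < f (\<psi> y / y)" using \<psi> pos by (simp add: pos_fun_def)
        then show "0 < \<theta> y" using \<open>0 < y\<close> k by (simp add: \<theta>_def)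
      qed
      have "(t n * (\<theta> (real (Suc n)) / real (Suc n))) ^ k = f (x n) * t n ^ k" for n
        unfolding \<theta> using k pos[OF xpos[of n]] by (simp add: power_mult_distrib)
      then have "emeasure lebesgue (duffin_schaeffer_set \<theta> :: (real ^ 'k) set) = 1"
        using conj1[OF \<theta>_pos] nsum by simp
      then show ?thesis
        using dim \<psi> True \<theta> scale dom
        by (intro hausdorff_measure_duffin_schaeffer_infinite[of \<psi> f \<theta>] pos mono)
           (auto simp: x_def[abs_def] k_def dimension_function_def)
    qed
    moreover from this have "hausdorff_measure f ?Q = \<infinity>"
      using Sle by (simp add: top_unique)
    ultimately show ?thesis by simp
  qed
qed

end
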